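(* Let $A_1$ be a $\mathbb Z$-valued ordered oriented flat virtual link invariant and let $\{(F_i,w_i,h_i,u_i)\}_{i\in\mathbb N}$ be a sequence such that $F_i$ is an even weight function with values in $\mathcal{VL}_{\mathrm{flat}}$, $w_i$ is a $\mathbb Z$-valued even weight function, $h_i\in\mathbb Z$, and $u_i$ is a $\mathbb Z$-valued odd weight function with $R(u_i,D)\subset\{0\}$ for all link diagrams $D$. Let $A_{i+1}(D)=I_f(D;u_i*(A_i\circ F_i),w_i,h_i)$ for $i\ge1$. Let $S=\{s_1,\dots,s_k\}$ be a finite set of weight functions with $s_i=A_{m_i}\circ F_{m_i}$ for some $m_i\in\mathbb N$, let $w$ be a $\mathbb Z$-valued odd weight function, and let $v$ be a $\mathbb Z$-valued even weight function such that $R(v,D)\subset\{0\}$ for all $D$. Then $$F(t,\ell_1,\dots,\ell_k)=\sum_{c\in C(D)}w(c)\,t^{v(c)}\ell_1^{s_1(c)}\cdots\ell_k^{s_k(c)}-\sum_{c\in T(D)}w(c)\,\ell_1^{s_1(c)}\cdots\ell_k^{s_k(c)}-\sum_{c\in C(D)\setminus T(D)}w(c)\,\ell_1^{A_{m_1}(D)}\cdots\ell_k^{A_{m_k}(D)}$$ is a link invariant (of ordered oriented virtual links $L$, computed from any diagram $D$ of $L$), where $$T(D)=\{c\in C(D)\mid s_i(c)\in R(s_i,L)\ \text{for all } i\}.$$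
   Context: Diagrams. A virtual link diagram is a 4-regular plane diagram of immersed oriented circles in which every vertex is marked as a classical crossing (with over/under information) or as a virtual crossing. It is ordered if its $n$ components are labelled by $1,\dots,n$. Generalized Reidemeister moves are the classical moves RI, RII, RIII, the virtual moves VRI, VRII, VRIII, and the move SV, in which a strand having two virtual crossings with the two strands of a classical crossing is moved across that crossing (all orientations; labels respected). Ordered oriented virtual links are diagrams modulo these moves; ordered oriented flat virtual links are diagrams modulo these moves and crossing changes (switching over and under at a classical crossing). $C(D)$ is the set of classical crossings of $D$. $\mathcal{VL}_{\mathrm{flat}}$ is the free $\mathbb Z$-module generated by ordered oriented flat virtual links; a flat invariant with values in $\mathbb Z$ is extended linearly to $\mathcal{VL}_{\mathrm{flat}}\to\mathbb Z$. Weight functions. A function $w$ assigning to every classical crossing of every ordered oriented virtual link diagram an element of an abelian group $G$ is a weight function if: (C1) a crossing not involved in a generalized Reidemeister move has the same weight before and after the move; (C2) each of the three crossings involved in an RIII move has the same weight as the corresponding crossing after the move; (C3) the classical crossing involved in an SV move has the same weight before and after. It is odd (even) if the two crossings $\alpha,\beta$ involved in any RII move satisfy $w(\beta)=-w(\alpha)$ (respectively $w(\beta)=w(\alpha)$). Standing assumption: all weight functions are local with respect to crossing changes, i.e. a crossing change at $c_0$ does not alter the weight of any other crossing. The product is $(u*v)(c)=u(c)v(c)$. $D^*$ is the diagram obtained from $D$ by changing all classical crossings, $c^*$ is the crossing of $D^*$ corresponding to $c$, and $w^*(c)=w(c^* )$. $R(w,D)$ is the set of values $w(c)$ over the crossings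 $c$ of $D$ that can be removed by a single RI move, and $R(w,L)$ is the union of $R(w,D)$ over all diagrams $D$ of $L$. Flat I-function: $I_f(D;v,w,g)=\sum_{c:\,w(c)=g}v(c)+\sum_{c:\,w^*(c)=g}v^*(c)$, sums over classical crossings $c$ of $D$. (By the paper's recursive construction all $A_i$ are $\mathbb Z$-valued ordered oriented flat virtual link invariants and all $A_i\circ F_i$ are even weight functions.) *)

theory Defs
  imports "HOL-Analysis.Analysis" "HOL-Library.Poly_Mapping"
begin

text \<open>
  A tangle is a list of polygonal strands in the square \<open>square\<close>, each given by its vertices.
  Every crossing of a tangle is a vertex of both branches through it. The flag at such a vertex says
  that this branch is the over-branch of a classical crossing; at a virtual crossing neither branch
  is flagged, and vertices that are not crossings are never flagged.
\<close>

type_synonym strand = "(complex \<times> bool) list"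
type_synonym tangle = "strand list"

definition square :: "complex set" where
  "square = cbox (Complex (-2) (-2)) (Complex 2 2)"

text \<open>A strand with \<open>m + 1\<close> vertices is at its \<open>k\<close>-th vertex at time \<open>k / m\<close>. At time 1 the
  out-of-range vertex gets the weight 0 in \<open>linepath\<close>.\<close>

definition strand_point :: "strand \<Rightarrow> real \<Rightarrow> complex" where
  "strand_point vs s =
    (let u = s * real (length vs - 1); k = nat \<lfloor>u\<rfloor>
     in linepath (fst (vs ! k)) (fst (vs ! Suc k)) (frac u))"

definition strand_over :: "strand \<Rightarrow> real \<Rightarrow> bool" where
  "strand_over vs s \<longleftrightarrow>
    (\<exists>k<length vs. s * real (length vs - 1) = real k \<and> snd (vs ! k))"

definition cross :: "bool \<Rightarrow> bool \<Rightarrow> tangle" where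
  "cross x y =
    [[(Complex (-2) 0, False), (Complex 0 0, x), (Complex 2 0, False)],
     [(Complex 0 (-2), False), (Complex 0 0, y), (Complex 0 2, False)]]"

definition kink :: "bool \<Rightarrow> bool \<Rightarrow> tangle" where
  "kink x y =
    [[(Complex (-2) 0, False), (Complex 0 0, x), (Complex 1 1, False),
      (Complex (-1) 1, False), (Complex 0 0, y), (Complex 2 0, False)]]"

definition no_kink :: tangle where
  "no_kink = [[(Complex (-2) 0, False), (Complex 2 0, False)]]"

definition bigon :: "bool \<Rightarrow> bool \<Rightarrow> tangle" where
  "bigon x y =
    [[(Complex (-2) 1, False), (Complex (-1) 0, x), (Complex 0 (-1), False),
      (Complex 1 0, x), (Complex 2 1, False)],
     [(Complex (-2) (-1), False), (Complex (-1) 0, y), (Complex 0 1, False),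
      (Complex 1 0, y), (Complex 2 (-1), False)]]"

definition no_bigon :: tangle where
  "no_bigon =
    [[(Complex (-2) 1, False), (Complex 2 1, False)],
     [(Complex (-2) (-1), False), (Complex 2 (-1), False)]]"

text \<open>Strand 0 passes below, respectively above, the crossing of the two diagonals (strands 1
  and 2) at the origin. \<open>f j k\<close> says that strand \<open>j\<close> goes over strand \<open>k\<close> at a classical
  crossing; the crossing of \<open>j\<close> and \<open>k\<close> is virtual if neither \<open>f j k\<close> nor \<open>f k j\<close>.\<close>

definition triangle :: "(nat \<Rightarrow> nat \<Rightarrow> bool) \<Rightarrow> tangle" where
  "triangle f =
    [[(Complex (-2) 0, False), (Complex (-1) (-1), f 0 1), (Complex 1 (-1), f 0 2),
      (Complex 2 0, False)],
     [(Complex (-2) (-2), False), (Complex (-1) (-1), f 1 0), (Complex 0 0, f 1 2),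
      (Complex 2 2, False)],
     [(Complex (-2) 2, False), (Complex 0 0, f 2 1), (Complex 1 (-1), f 2 0),
      (Complex 2 (-2), False)]]"

definition moved_triangle :: "(nat \<Rightarrow> nat \<Rightarrow> bool) \<Rightarrow> tangle" where
  "moved_triangle f =
    [[(Complex (-2) 0, False), (Complex (-1) 1, f 0 2), (Complex 1 1, f 0 1),
      (Complex 2 0, False)],
     [(Complex (-2) (-2), False), (Complex 0 0, f 1 2), (Complex 1 1, f 1 0),
      (Complex 2 2, False)],
     [(Complex (-2) 2, False), (Complex (-1) 1, f 2 0), (Complex 0 0, f 2 1),
      (Complex 2 (-2), False)]]"

text \<open>
  The component \<open>i \<in> {1..n}\<close> is the image of the oriented circle \<open>{i} \<times> sphere 0 1\<close>. The set
  \<open>over\<close> contains, for every classical crossing, the preimage on the over-branch, and nothing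
  else; the double points without a preimage in \<open>over\<close> are the virtual crossings.
\<close>

record pre_diagram =
  num_components :: nat
  curve :: "nat \<times> complex \<Rightarrow> complex"
  over :: "(nat \<times> complex) set"

definition circles :: "pre_diagram \<Rightarrow> (nat \<times> complex) set" where
  "circles D = {1..num_components D} \<times> sphere 0 1"

definition double_points :: "pre_diagram \<Rightarrow> complex set" where
  "double_points D =
    {p. \<exists>x\<in>circles D. \<exists>y\<in>circles D. x \<noteq> y \<and> curve D x = p \<and> curve D y = p}"

definition plane_homeo :: "(complex \<Rightarrow> complex) \<Rightarrow> bool" where
  "plane_homeo \<psi> \<longleftrightarrow> (\<exists>\<psi>'. homeomorphism UNIV UNIV \<psi> \<psi>')"

text \<open>
  Inside the disc \<open>\<psi> ` square\<close> the diagram is the image of the tangle \<open>T\<close> under \<open>\<psi>\<close>, where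
  \<open>\<sigma>\<close> tells which arc of which circle traces which strand. Neither \<open>\<psi>\<close> nor \<open>\<sigma>\<close> is required to
  preserve orientations: all strand orientations and all plane reflections of the pictures
  are covered.
\<close>

definition displays ::
  "pre_diagram \<Rightarrow> (complex \<Rightarrow> complex) \<Rightarrow> tangle \<Rightarrow> (nat \<times> real \<Rightarrow> nat \<times> complex) \<Rightarrow> bool" where
  "displays D \<psi> T \<sigma> \<longleftrightarrow>
    (let I = {..<length T} \<times> {0..1} in
      continuous_on I \<sigma> \<and> inj_on \<sigma> I \<and>
      \<sigma> ` I = {x \<in> circles D. curve D x \<in> \<psi> ` square} \<and>
      (\<forall>(j, s)\<in>I. curve D (\<sigma> (j, s)) = \<psi> (strand_point (T ! j) s) \<and>
        (\<sigma> (j, s) \<in> over D \<longleftrightarrow> strand_over (T ! j) s)))"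

text \<open>
  The circles are topologically immersed and form a 4-regular plane graph: there are finitely many
  multiple points, and near each of them the diagram is two branches crossing transversally.
\<close>

definition is_diagram :: "pre_diagram \<Rightarrow> bool" where
  "is_diagram D \<longleftrightarrow>
    0 < num_components D \<and>
    continuous_on (circles D) (curve D) \<and>
    finite (double_points D) \<and>
    (\<forall>p\<in>double_points D. \<exists>\<psi> \<sigma> x y. plane_homeo \<psi> \<and> \<psi> 0 = p \<and> \<not> (x \<and> y) \<and>
       displays D \<psi> (cross x y) \<sigma>) \<and>
    over D \<subseteq> {x \<in> circles D. curve D x \<in> double_points D}"

lemma is_diagram_unknot: "is_diagram \<lparr>num_components = 1, curve = snd, over = {}\<rparr>"
  by (auto simp: is_diagram_def double_points_def circles_def intro: continuous_intros)

typedef vdiagram = "{D. is_diagram D}"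
  morphisms raw Diagram
  using is_diagram_unknot by blast

setup_lifting type_definition_vdiagram

definition crossings :: "vdiagram \<Rightarrow> complex set" where
  "crossings D = curve (raw D) ` over (raw D)"

text \<open>Interchange over and under at all classical crossings lying in \<open>X\<close>.\<close>

definition pre_switch :: "complex set \<Rightarrow> pre_diagram \<Rightarrow> pre_diagram" where
  "pre_switch X D = D\<lparr>over :=
     {x \<in> over D. curve D x \<notin> X} \<union>
     {x \<in> circles D. x \<notin> over D \<and> curve D x \<in> X \<and> (\<exists>y\<in>over D. curve D y = curve D x)}\<rparr>"

lemma pre_switch_simps [simp]:
  "num_components (pre_switch X D) = num_components D"
  "curve (pre_switch X D) = curve D"
  "circles (pre_switch X D) = circles D"
  "double_points (pre_switch X D) = double_points D"
  by (simp_all add: pre_switch_def circles_def double_points_def)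

lemma strand_over_cross:
  assumes "j < 2"
  shows "strand_over (cross x y ! j) s \<longleftrightarrow> s = 1/2 \<and> (if j = 0 then x else y)"
proof -
  let ?vs = "cross x y ! j"
  consider "j = 0" | "j = 1" using assms by linarith
  then have vs: "length ?vs = 3" "\<not> snd (?vs ! 0)" "snd (?vs ! 1) \<longleftrightarrow> (if j = 0 then x else y)"
    "\<not> snd (?vs ! 2)"
    by (cases; simp add: cross_def)+
  have "(\<exists>n<3. P n) \<longleftrightarrow> P 0 \<or> P 1 \<or> P 2" for P :: "nat \<Rightarrow> bool"
    by (auto simp: numeral_3_eq_3 numeral_2_eq_2 less_Suc_eq)
  then have "strand_over ?vs s \<longleftrightarrow> s * 2 = 1 \<and> (if j = 0 then x else y)"
    unfolding strand_over_def vs(1) using vs(2-4) by simp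
  then show ?thesis by (simp add: field_simps)
qed

lemma strand_point_cross:
  assumes "j < 2" "s \<in> {0..1}"
  shows "strand_point (cross x y ! j) s =
    (if j = 0 then Complex (4 * s - 2) 0 else Complex 0 (4 * s - 2))"
proof -
  let ?vs = "cross x y ! j"
  let ?z = "\<lambda>r. if j = 0 then Complex r 0 else Complex 0 r"
  consider "j = 0" | "j = 1" using assms by linarith
  then have vs: "length ?vs = 3" "fst (?vs ! 0) = ?z (-2)" "fst (?vs ! 1) = ?z 0"
    "fst (?vs ! 2) = ?z 2"
    by (cases; simp add: cross_def)+
  have len: "real (length ?vs - 1) = 2" by (simp add: vs(1))
  consider (a) "\<lfloor>s * 2\<rfloor> = 0" | (b) "\<lfloor>s * 2\<rfloor> = 1" | (c) "s = 1"
    using assms(2) unfolding floor_eq_iff by fastforce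
  then show ?thesis
  proof cases
    case a
    have "strand_point ?vs s = linepath (?z (-2)) (?z 0) (s * 2)"
      unfolding strand_point_def Let_def len a frac_def vs(2,3)[symmetric] by simp
    then show ?thesis by (simp add: linepath_def complex_eq_iff)
  next
    case b
    have "nat 1 = 1" "Suc 1 = 2" by simp_all
    then have "strand_point ?vs s = linepath (?z 0) (?z 2) (s * 2 - 1)"
      unfolding strand_point_def Let_def len b frac_def vs(3,4)[symmetric] by (simp only: of_int_1)
    then show ?thesis by (simp add: linepath_def complex_eq_iff)
  next
    case c
    have u: "\<lfloor>s * 2\<rfloor> = 2" "frac (s * 2) = 0" using c by (simp_all add: frac_def)
    have "strand_point ?vs s = ?z 2"
      unfolding strand_point_def Let_def len u using vs(4) by (simp add: linepath_def)
    then show ?thesis using c by simp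
  qed
qed

lemma displays_cross_switch:
  assumes \<psi>: "plane_homeo \<psi>" and d: "displays D \<psi> (cross x y) \<sigma>"
    and ov: "over D \<subseteq> circles D" and xy: "\<not> (x \<and> y)"
  obtains x' y' where "\<not> (x' \<and> y')" "displays (pre_switch X D) \<psi> (cross x' y') \<sigma>"
proof -
  define sw where "sw \<longleftrightarrow> \<psi> 0 \<in> X \<and> (x \<or> y)"
  define x' y' where "x' = (if sw then y else x)" and "y' = (if sw then x else y)"
  define I where "I = {..<2::nat} \<times> {0..1::real}"
  have len: "length (cross a b) = 2" for a b by (simp add: cross_def)
  have inj: "inj \<psi>"
    using \<psi> by (auto simp: plane_homeo_def homeomorphism_def inj_on_def) metis
  note d' = d[unfolded displays_def len Let_def, folded I_def]
  have cont: "continuous_on I \<sigma>" and injs: "inj_on \<sigma> I"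
    and im: "\<sigma> ` I = {x \<in> circles D. curve D x \<in> \<psi> ` square}"
    using d' by blast+
  have cv: "curve D (\<sigma> (j, t)) = \<psi> (strand_point (cross x y ! j) t)"
    and fl: "\<sigma> (j, t) \<in> over D \<longleftrightarrow> t = 1/2 \<and> (if j = 0 then x else y)"
    if "(j, t) \<in> I" for j t
    using d' that strand_over_cross[of j x y t] by (auto simp: I_def)
  have zero: "strand_point (cross x y ! j) t = 0 \<longleftrightarrow> t = 1/2" if "(j, t) \<in> I" for j t
    using that strand_point_cross[of j t x y] by (auto simp: I_def complex_eq_iff)
  have same: "strand_point (cross x' y' ! j) t = strand_point (cross x y ! j) t"
    if "(j, t) \<in> I" for j t
    using that strand_point_cross[of j t] by (auto simp: I_def)
  have mid: "(0, 1/2) \<in> I" "(1, 1/2) \<in> I" by (auto simp: I_def)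
  have part: "(\<exists>z\<in>over D. curve D z = curve D (\<sigma> (j, t))) \<longleftrightarrow> t = 1/2 \<and> (x \<or> y)"
    if jt: "(j, t) \<in> I" for j t
  proof
    assume "\<exists>z\<in>over D. curve D z = curve D (\<sigma> (j, t))"
    then obtain z where z: "z \<in> over D" "curve D z = curve D (\<sigma> (j, t))" by blast
    have "z \<in> \<sigma> ` I" using z ov im jt by auto
    then obtain j' t' where z': "z = \<sigma> (j', t')" "(j', t') \<in> I" by auto
    then have a: "t' = 1/2" "x \<or> y" using z(1) fl by (auto split: if_splits)
    have "\<psi> (strand_point (cross x y ! j) t) = \<psi> 0"
      using z(2) z' cv[OF jt] cv[OF z'(2)] zero[OF z'(2)] a by simp
    then show "t = 1/2 \<and> (x \<or> y)" using inj zero[OF jt] a by (auto dest: injD)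
  next
    assume a: "t = 1/2 \<and> (x \<or> y)"
    have "curve D (\<sigma> (j, t)) = \<psi> 0" using cv[OF jt] zero[OF jt] a by metis
    moreover have "curve D (\<sigma> (0, 1/2)) = \<psi> 0" "curve D (\<sigma> (1, 1/2)) = \<psi> 0"
      using cv[OF mid(1)] zero[OF mid(1)] cv[OF mid(2)] zero[OF mid(2)] by simp_all
    moreover have "\<sigma> (0, 1/2) \<in> over D \<or> \<sigma> (1, 1/2) \<in> over D"
      using fl[OF mid(1)] fl[OF mid(2)] a by simp
    ultimately show "\<exists>z\<in>over D. curve D z = curve D (\<sigma> (j, t))" by metis
  qed
  have new: "\<sigma> (j, t) \<in> over (pre_switch X D) \<longleftrightarrow> strand_over (cross x' y' ! j) t"
    if jt: "(j, t) \<in> I" for j t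
  proof -
    have c: "\<sigma> (j, t) \<in> circles D" using jt im by blast
    have "j < 2" using jt by (simp add: I_def)
    have p0: "curve D (\<sigma> (j, t)) = \<psi> 0" if "t = 1/2"
      using cv[OF jt] zero[OF jt] that by metis
    have "\<sigma> (j, t) \<in> over (pre_switch X D) \<longleftrightarrow>
        (\<sigma> (j, t) \<in> over D \<and> curve D (\<sigma> (j, t)) \<notin> X) \<or>
        (\<sigma> (j, t) \<notin> over D \<and> curve D (\<sigma> (j, t)) \<in> X \<and>
          (\<exists>z\<in>over D. curve D z = curve D (\<sigma> (j, t))))"
      using c by (simp add: pre_switch_def)
    also have "\<dots> \<longleftrightarrow>
        (t = 1/2 \<and> (if j = 0 then x else y) \<and> \<psi> 0 \<notin> X) \<or>
        (\<not> (if j = 0 then x else y) \<and> \<psi> 0 \<in> X \<and> t = 1/2 \<and> (x \<or> y))"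
      unfolding fl[OF jt] part[OF jt] using p0 by metis
    also have "\<dots> \<longleftrightarrow> t = 1/2 \<and> (if j = 0 then x' else y')"
      using xy by (cases "j = 0"; cases "\<psi> 0 \<in> X"; cases x; cases y)
        (simp_all add: x'_def y'_def sw_def)
    finally have "\<sigma> (j, t) \<in> over (pre_switch X D) \<longleftrightarrow> t = 1/2 \<and> (if j = 0 then x' else y')" .
    then show ?thesis using strand_over_cross[OF \<open>j < 2\<close>] by simp
  qed
  have "displays (pre_switch X D) \<psi> (cross x' y') \<sigma>"
    using cont injs im cv same new
    unfolding displays_def len Let_def I_def[symmetric] by auto
  moreover have "\<not> (x' \<and> y')" using xy by (auto simp: x'_def y'_def)
  ultimately show ?thesis using that by blast
qed

lemma is_diagram_pre_switch:
  assumes "is_diagram D"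
  shows "is_diagram (pre_switch X D)"
proof -
  have ov: "over D \<subseteq> circles D"
    and ov2: "over D \<subseteq> {x \<in> circles D. curve D x \<in> double_points D}"
    using assms by (auto simp: is_diagram_def)
  have "\<exists>\<psi> \<sigma> x y. plane_homeo \<psi> \<and> \<psi> 0 = p \<and> \<not> (x \<and> y) \<and>
      displays (pre_switch X D) \<psi> (cross x y) \<sigma>" if "p \<in> double_points D" for p
  proof -
    have "\<exists>\<psi> \<sigma> x y. plane_homeo \<psi> \<and> \<psi> 0 = p \<and> \<not> (x \<and> y) \<and> displays D \<psi> (cross x y) \<sigma>"
      using assms that by (simp add: is_diagram_def)
    then obtain \<psi> \<sigma> x y where *: "plane_homeo \<psi>" "\<psi> 0 = p" "\<not> (x \<and> y)"
      "displays D \<psi> (cross x y) \<sigma>"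
      by (elim exE conjE)
    from displays_cross_switch[OF *(1) *(4) ov *(3), of X] obtain x' y'
      where "\<not> (x' \<and> y')" "displays (pre_switch X D) \<psi> (cross x' y') \<sigma>" .
    with *(1,2) show ?thesis by (intro exI conjI)
  qed
  moreover have "over (pre_switch X D) \<subseteq> {x \<in> circles D. curve D x \<in> double_points D}"
    using ov2 by (auto simp: pre_switch_def)
  ultimately show ?thesis using assms by (simp add: is_diagram_def)
qed

lift_definition switch :: "complex set \<Rightarrow> vdiagram \<Rightarrow> vdiagram" is pre_switch
  by (rule is_diagram_pre_switch)

definition mirror :: "vdiagram \<Rightarrow> vdiagram" where
  "mirror D = switch (crossings D) D"

definition isotopic_to_id :: "complex set \<Rightarrow> (complex \<Rightarrow> complex) \<Rightarrow> bool" where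
  "isotopic_to_id S h \<longleftrightarrow>
    homotopic_with_canon (\<lambda>f. \<exists>f'. homeomorphism S S f f') S S id h"

text \<open>Plane isotopy \<open>h\<close>, together with an orientation preserving reparametrization of every
  component.\<close>

definition plane_isotopy :: "(complex \<Rightarrow> complex) \<Rightarrow> vdiagram \<Rightarrow> vdiagram \<Rightarrow> bool" where
  "plane_isotopy h D D' \<longleftrightarrow>
    isotopic_to_id UNIV h \<and>
    num_components (raw D') = num_components (raw D) \<and>
    (\<exists>r. \<forall>i\<in>{1..num_components (raw D)}. isotopic_to_id (sphere 0 1) (r i) \<and>
      (\<forall>z\<in>sphere 0 1.
        curve (raw D') (i, z) = h (curve (raw D) (i, r i z)) \<and>
        ((i, z) \<in> over (raw D') \<longleftrightarrow> (i, r i z) \<in> over (raw D))))"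

text \<open>\<open>D'\<close> arises from \<open>D\<close> by replacing the tangle \<open>T\<close> in the disc \<open>\<psi> ` square\<close> by \<open>T'\<close>.
  Corresponding strands are traced by the same arcs of the circles.\<close>

definition replaces ::
  "(complex \<Rightarrow> complex) \<Rightarrow> tangle \<Rightarrow> tangle \<Rightarrow> vdiagram \<Rightarrow> vdiagram \<Rightarrow> bool" where
  "replaces \<psi> T T' D D' \<longleftrightarrow>
    plane_homeo \<psi> \<and>
    num_components (raw D') = num_components (raw D) \<and>
    (\<exists>\<sigma>. displays (raw D) \<psi> T \<sigma> \<and> displays (raw D') \<psi> T' \<sigma>) \<and>
    (\<forall>x\<in>circles (raw D). curve (raw D) x \<notin> \<psi> ` square \<longrightarrow>
      curve (raw D') x = curve (raw D) x \<and> (x \<in> over (raw D') \<longleftrightarrow> x \<in> over (raw D)))"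

definition RI :: "(complex \<Rightarrow> complex) \<Rightarrow> vdiagram \<Rightarrow> vdiagram \<Rightarrow> bool" where
  "RI \<psi> D D' \<longleftrightarrow> (\<exists>x y. x \<noteq> y \<and> replaces \<psi> (kink x y) no_kink D D')"

definition RII :: "(complex \<Rightarrow> complex) \<Rightarrow> vdiagram \<Rightarrow> vdiagram \<Rightarrow> bool" where
  "RII \<psi> D D' \<longleftrightarrow> (\<exists>x y. x \<noteq> y \<and> replaces \<psi> (bigon x y) no_bigon D D')"

definition RIII :: "(complex \<Rightarrow> complex) \<Rightarrow> vdiagram \<Rightarrow> vdiagram \<Rightarrow> bool" where
  "RIII \<psi> D D' \<longleftrightarrow>
    (\<exists>height :: nat \<Rightarrow> nat. inj_on height {..<3} \<and>
      (let f = (\<lambda>j k. height j > height k)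
       in replaces \<psi> (triangle f) (moved_triangle f) D D'))"

definition VRI :: "(complex \<Rightarrow> complex) \<Rightarrow> vdiagram \<Rightarrow> vdiagram \<Rightarrow> bool" where
  "VRI \<psi> D D' \<longleftrightarrow> replaces \<psi> (kink False False) no_kink D D'"

definition VRII :: "(complex \<Rightarrow> complex) \<Rightarrow> vdiagram \<Rightarrow> vdiagram \<Rightarrow> bool" where
  "VRII \<psi> D D' \<longleftrightarrow> replaces \<psi> (bigon False False) no_bigon D D'"

definition VRIII :: "(complex \<Rightarrow> complex) \<Rightarrow> vdiagram \<Rightarrow> vdiagram \<Rightarrow> bool" where
  "VRIII \<psi> D D' \<longleftrightarrow>
    replaces \<psi> (triangle (\<lambda>j k. False)) (moved_triangle (\<lambda>j k. False)) D D'"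

definition SV :: "(complex \<Rightarrow> complex) \<Rightarrow> vdiagram \<Rightarrow> vdiagram \<Rightarrow> bool" where
  "SV \<psi> D D' \<longleftrightarrow>
    (\<exists>p \<in> {(1, 2), (2, 1)}. let f = (\<lambda>j k. (j, k) = p)
       in replaces \<psi> (triangle f) (moved_triangle f) D D')"

definition local_move :: "(complex \<Rightarrow> complex) \<Rightarrow> vdiagram \<Rightarrow> vdiagram \<Rightarrow> bool" where
  "local_move \<psi> D D' \<longleftrightarrow>
    RI \<psi> D D' \<or> RII \<psi> D D' \<or> RIII \<psi> D D' \<or>
    VRI \<psi> D D' \<or> VRII \<psi> D D' \<or> VRIII \<psi> D D' \<or> SV \<psi> D D'"

definition reidemeister_step :: "vdiagram \<Rightarrow> vdiagram \<Rightarrow> bool" where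
  "reidemeister_step D D' \<longleftrightarrow> (\<exists>h. plane_isotopy h D D') \<or> (\<exists>\<psi>. local_move \<psi> D D')"

definition crossing_change :: "vdiagram \<Rightarrow> vdiagram \<Rightarrow> bool" where
  "crossing_change D D' \<longleftrightarrow> (\<exists>c\<in>crossings D. D' = switch {c} D)"

quotient_type virtual_link = vdiagram / "equivclp reidemeister_step"
  morphisms diagram_of_link link_of
  by (rule equivp_evquivclp)

quotient_type flat_link =
  vdiagram / "equivclp (\<lambda>D D'. reidemeister_step D D' \<or> crossing_change D D')"
  morphisms diagram_of_flat_link flat_link_of
  by (rule equivp_evquivclp)

definition link_invariant :: "(vdiagram \<Rightarrow> 'b) \<Rightarrow> bool" where
  "link_invariant A \<longleftrightarrow> (\<forall>D D'. link_of D = link_of D' \<longrightarrow> A D = A D')"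

definition flat_invariant :: "(vdiagram \<Rightarrow> 'b) \<Rightarrow> bool" where
  "flat_invariant A \<longleftrightarrow> (\<forall>D D'. flat_link_of D = flat_link_of D' \<longrightarrow> A D = A D')"

text \<open>The finitely supported functions \<open>flat_link \<Rightarrow>\<^sub>0 int\<close> are the free abelian group on the
  flat links. The extension below is meant for flat invariants \<open>A\<close>, for which the choice of
  the representing diagrams is irrelevant.\<close>

definition linear_extension :: "(vdiagram \<Rightarrow> int) \<Rightarrow> (flat_link \<Rightarrow>\<^sub>0 int) \<Rightarrow> int" where
  "linear_extension A X =
    (\<Sum>L\<in>Poly_Mapping.keys X. Poly_Mapping.lookup X L * A (diagram_of_flat_link L))"

text \<open>Crossings are points of the plane. Only the values at \<open>c \<in> crossings D\<close> matter.\<close>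

type_synonym 'g weight = "vdiagram \<Rightarrow> complex \<Rightarrow> 'g"

text \<open>A plane isotopy involves no crossing; a local move involves exactly the crossings in its
  disc.\<close>

definition uninvolved_preserved :: "'g weight \<Rightarrow> bool" where
  "uninvolved_preserved w \<longleftrightarrow>
    (\<forall>h D D'. plane_isotopy h D D' \<longrightarrow> (\<forall>c\<in>crossings D. w D' (h c) = w D c)) \<and>
    (\<forall>\<psi> D D'. local_move \<psi> D D' \<longrightarrow>
      (\<forall>c\<in>crossings D. c \<notin> \<psi> ` square \<longrightarrow> w D' c = w D c))"

text \<open>The crossings of the strands 0 and 1, 0 and 2, 1 and 2 before and after the move.\<close>

definition RIII_preserved :: "'g weight \<Rightarrow> bool" where
  "RIII_preserved w \<longleftrightarrow>
    (\<forall>\<psi> D D'. RIII \<psi> D D' \<longrightarrow>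
      w D' (\<psi> (Complex 1 1)) = w D (\<psi> (Complex (-1) (-1))) \<and>
      w D' (\<psi> (Complex (-1) 1)) = w D (\<psi> (Complex 1 (-1))) \<and>
      w D' (\<psi> 0) = w D (\<psi> 0))"

definition SV_preserved :: "'g weight \<Rightarrow> bool" where
  "SV_preserved w \<longleftrightarrow> (\<forall>\<psi> D D'. SV \<psi> D D' \<longrightarrow> w D' (\<psi> 0) = w D (\<psi> 0))"

definition crossing_change_local :: "'g weight \<Rightarrow> bool" where
  "crossing_change_local w \<longleftrightarrow>
    (\<forall>D. \<forall>c\<^sub>0\<in>crossings D. \<forall>c\<in>crossings D - {c\<^sub>0}. w (switch {c\<^sub>0} D) c = w D c)"

definition weight_function :: "'g :: ab_group_add weight \<Rightarrow> bool" where
  "weight_function w \<longleftrightarrow>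
    uninvolved_preserved w \<and> RIII_preserved w \<and> SV_preserved w \<and> crossing_change_local w"

definition odd_weight :: "'g :: ab_group_add weight \<Rightarrow> bool" where
  "odd_weight w \<longleftrightarrow> weight_function w \<and>
    (\<forall>\<psi> D D'. RII \<psi> D D' \<longrightarrow> w D (\<psi> (Complex 1 0)) = - w D (\<psi> (Complex (-1) 0)))"

definition even_weight :: "'g :: ab_group_add weight \<Rightarrow> bool" where
  "even_weight w \<longleftrightarrow> weight_function w \<and>
    (\<forall>\<psi> D D'. RII \<psi> D D' \<longrightarrow> w D (\<psi> (Complex 1 0)) = w D (\<psi> (Complex (-1) 0)))"

definition RI_values :: "'g weight \<Rightarrow> vdiagram \<Rightarrow> 'g set" where
  "RI_values w D = {w D c | c. \<exists>\<psi> D'. RI \<psi> D D' \<and> c = \<psi> 0}"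

definition RI_values_link :: "'g weight \<Rightarrow> virtual_link \<Rightarrow> 'g set" where
  "RI_values_link w L = (\<Union>D\<in>{D. link_of D = L}. RI_values w D)"

text \<open>The crossing of \<open>mirror D\<close> corresponding to \<open>c\<close> is the same point of the plane.\<close>

definition flat_I :: "vdiagram \<Rightarrow> int weight \<Rightarrow> 'g weight \<Rightarrow> 'g \<Rightarrow> int" where
  "flat_I D v w g =
    (\<Sum>c\<in>{c \<in> crossings D. w D c = g}. v D c) +
    (\<Sum>c\<in>{c \<in> crossings D. w (mirror D) c = g}. v (mirror D) c)"

definition weight_times :: "int weight \<Rightarrow> int weight \<Rightarrow> int weight" where
  "weight_times u v = (\<lambda>D c. u D c * v D c)"

definition weight_comp :: "(vdiagram \<Rightarrow> int) \<Rightarrow> (flat_link \<Rightarrow>\<^sub>0 int) weight \<Rightarrow> int weight" where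
  "weight_comp A F = (\<lambda>D c. linear_extension A (F D c))"

definition special_crossings :: "nat \<Rightarrow> (nat \<Rightarrow> int weight) \<Rightarrow> vdiagram \<Rightarrow> complex set" where
  "special_crossings k s D =
    {c \<in> crossings D. \<forall>i\<in>{1..k}. s i D c \<in> RI_values_link (s i) (link_of D)}"

text \<open>Integral Laurent polynomials as the group ring of the exponent vectors; the variable 0
  is \<open>t\<close> and the variable \<open>i \<ge> 1\<close> is \<open>\<ell>\<^sub>i\<close>. The term below is
  \<open>a t\<^sup>n \<ell>\<^sub>1^(e 1) \<dots> \<ell>\<^sub>k^(e k)\<close>.\<close>

type_synonym laurent = "(nat \<Rightarrow>\<^sub>0 int) \<Rightarrow>\<^sub>0 int"

definition laurent_term :: "nat \<Rightarrow> int \<Rightarrow> int \<Rightarrow> (nat \<Rightarrow> int) \<Rightarrow> laurent" where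
  "laurent_term k a n e =
    Poly_Mapping.single
      (Poly_Mapping.single 0 n + (\<Sum>i = 1..k. Poly_Mapping.single i (e i))) a"

end

theory Submission
  imports Defs
begin

text \<open>
  A sum over the crossings of a diagram is a link invariant as soon as its summand is preserved at
  uninvolved crossings and under RIII and SV, vanishes at the crossing of an RI move and cancels in
  an RII pair. For a weight that is local under crossing changes, changing \<open>c\<close> exchanges the
  contributions of \<open>c\<close> to the two halves of \<open>flat_I\<close>, so by induction all \<open>A i\<close> are flat invariants.
  The polynomial is again such a sum: a special crossing contributes the difference of the terms
  with \<open>t\<close> and without \<open>t\<close>, and the crossing of an RI move is special with \<open>v = 0\<close>.
\<close>

section \<open>Double points and crossing changes\<close>

text \<open>The second half of \<open>flat_I\<close> lives on \<open>mirror D\<close>, so the mirror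
  image of a Reidemeister step must again be a Reidemeister step. This is the geometric burden of
  the proof: diagrams are continuous maps, and a move is only known through a disc and the tangles
  displayed in it. The mirrored move keeps the disc, the homeomorphism \<open>\<psi>\<close> and the
  tracing map \<open>\<sigma>\<close>, so only flags have to be transferred; this works because a
  double point has exactly two preimages, a fact extracted from the local picture
  \<open>cross\<close>. The recursion closes because composition with \<open>A i\<close> preserves
  evenness, so multiplication by \<open>u i\<close> yields an odd weight that vanishes at RI
  crossings together with \<open>u i\<close>. In the polynomial, speciality is tested against
  \<open>RI_values_link (s i) (link_of D)\<close>, which refers to the whole link and so stays fixed
  under moves. For the remaining crossings, what matters about the exponent \<open>A (m i) D\<close>
  is that a step does not change it.\<close>

lemma plane_homeo_inj: "plane_homeo \<psi> \<Longrightarrow> inj \<psi>"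
  by (auto simp: plane_homeo_def homeomorphism_def inj_on_def) metis

lemma is_diagram_raw: "is_diagram (raw D)"
  using raw[of D] by simp

lemma over_raw: "x \<in> over (raw D) \<Longrightarrow> x \<in> circles (raw D) \<and> curve (raw D) x \<in> double_points (raw D)"
  using is_diagram_raw[of D] by (auto simp: is_diagram_def)

lemma finite_crossings [simp]: "finite (crossings D)"
proof (rule finite_subset)
  show "crossings D \<subseteq> double_points (raw D)"
    using over_raw by (auto simp: crossings_def)
  show "finite (double_points (raw D))"
    using is_diagram_raw[of D] by (simp add: is_diagram_def)
qed

text \<open>In the local picture \<open>cross\<close>, \<open>\<sigma>\<close> traces everything
  that the diagram has in the disc, and each of the two strands passes through 0 only at time
  1/2.\<close>

lemma double_point_preimages:
  assumes "is_diagram D" "p \<in> double_points D"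
  obtains a b where "a \<noteq> b" "{x \<in> circles D. curve D x = p} = {a, b}"
    "\<not> (a \<in> over D \<and> b \<in> over D)"
proof -
  have "\<exists>\<psi> \<sigma> x y. plane_homeo \<psi> \<and> \<psi> 0 = p \<and> \<not> (x \<and> y) \<and> displays D \<psi> (cross x y) \<sigma>"
    using assms by (simp add: is_diagram_def)
  then obtain \<psi> \<sigma> x y where \<psi>: "plane_homeo \<psi>" "\<psi> 0 = p" and xy: "\<not> (x \<and> y)"
    and d: "displays D \<psi> (cross x y) \<sigma>"
    by (elim exE conjE)
  define I where "I = {..<2::nat} \<times> {0..1::real}"
  have len: "length (cross x y) = 2" by (simp add: cross_def)
  note d' = d[unfolded displays_def len Let_def, folded I_def]
  have injs: "inj_on \<sigma> I" and im: "\<sigma> ` I = {x \<in> circles D. curve D x \<in> \<psi> ` square}"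
    using d' by blast+
  have cv: "curve D (\<sigma> (j, t)) = \<psi> (strand_point (cross x y ! j) t)"
    and fl: "\<sigma> (j, t) \<in> over D \<longleftrightarrow> t = 1/2 \<and> (if j = 0 then x else y)"
    if "(j, t) \<in> I" for j t
    using d' that strand_over_cross[of j x y t] by (auto simp: I_def)
  have zero: "curve D (\<sigma> (j, t)) = p \<longleftrightarrow> t = 1/2" if "(j, t) \<in> I" for j t
  proof -
    have "curve D (\<sigma> (j, t)) = p \<longleftrightarrow> strand_point (cross x y ! j) t = 0"
      using cv[OF that] \<psi> plane_homeo_inj[OF \<psi>(1)] by (metis injD)
    then show ?thesis
      using that strand_point_cross[of j t x y] by (auto simp: I_def complex_eq_iff)
  qed
  have mid: "(0, 1/2) \<in> I" "(1, 1/2) \<in> I" by (auto simp: I_def)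
  \<comment> \<open>Because the centre lies in the square, every preimage of \<open>p\<close> is in
    the range of \<open>\<sigma>\<close>.\<close>
  have "(0::complex) \<in> square" by (simp add: square_def in_cbox_complex_iff)
  then have "{x \<in> circles D. curve D x = p} = {x \<in> \<sigma> ` I. curve D x = p}"
    using im \<psi>(2) by auto
  also have "\<dots> = \<sigma> ` {(j, t). (j, t) \<in> I \<and> t = 1/2}"
  proof (intro equalityI subsetI)
    fix z assume z: "z \<in> {x \<in> \<sigma> ` I. curve D x = p}"
    then obtain j t where "(j, t) \<in> I" "z = \<sigma> (j, t)" by auto
    with z zero show "z \<in> \<sigma> ` {(j, t). (j, t) \<in> I \<and> t = 1/2}" by blast
  qed (use zero in auto)
  also have "{(j, t). (j, t) \<in> I \<and> t = 1/2} = {(0, 1/2), (1, 1/2)}"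
    by (auto simp: I_def)
  finally have "{x \<in> circles D. curve D x = p} = {\<sigma> (0, 1/2), \<sigma> (1, 1/2)}" by simp
  moreover have "\<sigma> (0, 1/2) \<noteq> \<sigma> (1, 1/2)"
    using injs mid by (auto simp: inj_on_def)
  moreover have "\<not> (\<sigma> (0, 1/2) \<in> over D \<and> \<sigma> (1, 1/2) \<in> over D)"
    using fl[OF mid(1)] fl[OF mid(2)] xy by simp
  ultimately show thesis using that by blast
qed

lemma over_unique:
  assumes "x \<in> circles (raw D)" "y \<in> circles (raw D)" "x \<noteq> y"
    "curve (raw D) x = curve (raw D) y" "x \<in> over (raw D)"
  shows "y \<notin> over (raw D)"
proof -
  have "curve (raw D) x \<in> double_points (raw D)" using over_raw assms by blast
  from double_point_preimages[OF is_diagram_raw this] show ?thesis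
    using assms by (smt (verit) insert_iff mem_Collect_eq singletonD)
qed

lemma preimage_cases:
  assumes "x \<in> circles (raw D)" "y \<in> circles (raw D)" "z \<in> circles (raw D)" "x \<noteq> y"
    "curve (raw D) x = curve (raw D) y" "curve (raw D) z = curve (raw D) x"
  shows "z = x \<or> z = y"
proof -
  have "curve (raw D) x \<in> double_points (raw D)"
    using assms by (auto simp: double_points_def)
  from double_point_preimages[OF is_diagram_raw this] show ?thesis
    using assms by (smt (verit) insert_iff mem_Collect_eq singletonD)
qed

lemma switch_simps [simp]:
  "num_components (raw (switch X D)) = num_components (raw D)"
  "curve (raw (switch X D)) = curve (raw D)"
  "circles (raw (switch X D)) = circles (raw D)"
  by (simp_all add: switch.rep_eq)

text \<open>\<open>pre_switch\<close> acts at a point only if some branch there is over, so virtual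
  crossings in \<open>X\<close> stay virtual; hence the intersection with
  \<open>crossings D\<close>.\<close>

lemma over_switch:
  "x \<in> over (raw (switch X D)) \<longleftrightarrow>
    (if curve (raw D) x \<in> crossings D \<inter> X then x \<in> circles (raw D) \<and> x \<notin> over (raw D)
     else x \<in> over (raw D))"
proof -
  have "curve (raw D) x \<in> crossings D \<longleftrightarrow> (\<exists>y\<in>over (raw D). curve (raw D) y = curve (raw D) x)"
    unfolding crossings_def image_iff by metis
  moreover have "x \<in> over (raw D) \<longrightarrow> curve (raw D) x \<in> crossings D"
    unfolding crossings_def by blast
  ultimately show ?thesis
    by (simp add: switch.rep_eq pre_switch_def) blast
qed

text \<open>A switched crossing still has an over-branch: its second preimage exists, and
  \<open>over_unique\<close> says that it was not flagged before.\<close>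

lemma crossings_switch [simp]: "crossings (switch X D) = crossings D"
proof (intro equalityI subsetI)
  fix p assume "p \<in> crossings (switch X D)"
  then obtain x where "x \<in> over (raw (switch X D))" "p = curve (raw D) x"
    by (auto simp: crossings_def)
  then show "p \<in> crossings D"
    unfolding over_switch by (metis Int_iff crossings_def imageI)
next
  fix p assume p: "p \<in> crossings D"
  then obtain x where x: "x \<in> over (raw D)" "p = curve (raw D) x"
    by (auto simp: crossings_def)
  show "p \<in> crossings (switch X D)"
  proof (cases "p \<in> X")
    case False
    then have "x \<in> over (raw (switch X D))" using x by (simp add: over_switch)
    then show ?thesis using x by (auto simp: crossings_def)
  next
    case True
    have "p \<in> double_points (raw D)" using over_raw x by blast
    then obtain a b where "a \<in> circles (raw D)" "b \<in> circles (raw D)" "a \<noteq> b"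
      "curve (raw D) a = p" "curve (raw D) b = p"
      unfolding double_points_def by blast
    then obtain y where y: "y \<in> circles (raw D)" "curve (raw D) y = p" "y \<noteq> x"
      by metis
    then have "y \<notin> over (raw D)" using over_unique x over_raw by metis
    then have "y \<in> over (raw (switch X D))" using y p True by (simp add: over_switch)
    then show ?thesis using y by (auto simp: crossings_def)
  qed
qed

text \<open>Switching a crossing twice restores it, so switches compose by symmetric difference. The
  interplay of \<open>mirror\<close> with crossing changes is computed from this.\<close>

lemma switch_switch: "switch X (switch Y D) = switch ((X - Y) \<union> (Y - X)) D"
proof -
  have "over (raw (switch X (switch Y D))) = over (raw (switch ((X - Y) \<union> (Y - X)) D))"
  proof (rule set_eqI)
    fix x
    have "x \<in> over (raw D) \<Longrightarrow> x \<in> circles (raw D)" using over_raw by blast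
    then show "x \<in> over (raw (switch X (switch Y D))) \<longleftrightarrow>
        x \<in> over (raw (switch ((X - Y) \<union> (Y - X)) D))"
      unfolding over_switch crossings_switch switch_simps
      by (cases "curve (raw D) x \<in> X"; cases "curve (raw D) x \<in> Y";
          cases "curve (raw D) x \<in> crossings D"; simp; blast)
  qed
  then have "raw (switch X (switch Y D)) = raw (switch ((X - Y) \<union> (Y - X)) D)"
    by (intro pre_diagram.equality) (simp_all add: switch.rep_eq pre_switch_def)
  then show ?thesis by (simp add: raw_inject)
qed

lemma switch_empty [simp]: "switch {} D = D"
proof -
  have "raw (switch {} D) = raw D"
    by (simp add: switch.rep_eq pre_switch_def)
  then show ?thesis by (simp add: raw_inject)
qed

lemma switch_twice: "switch X (switch X D) = D"
  by (simp add: switch_switch)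

lemma mirror_simps [simp]:
  "num_components (raw (mirror D)) = num_components (raw D)"
  "curve (raw (mirror D)) = curve (raw D)"
  "circles (raw (mirror D)) = circles (raw D)"
  "crossings (mirror D) = crossings D"
  by (simp_all add: mirror_def)

lemma over_mirror:
  "x \<in> over (raw (mirror D)) \<longleftrightarrow>
    x \<in> circles (raw D) \<and> curve (raw D) x \<in> crossings D \<and> x \<notin> over (raw D)"
proof -
  have "x \<in> over (raw D) \<longrightarrow> curve (raw D) x \<in> crossings D"
    unfolding crossings_def by blast
  then show ?thesis by (simp add: mirror_def over_switch) blast
qed

lemma switch_mirror: "switch X (mirror D) = mirror (switch X D)"
  by (simp add: mirror_def switch_switch Un_commute)

lemma crossing_change_local_switch:
  assumes "crossing_change_local w" "finite X" "X \<subseteq> crossings D" "c \<in> crossings D - X"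
  shows "w (switch X D) c = w D c"
  using assms(2-4)
proof (induction X rule: finite_induct)
  case empty
  show ?case by simp
next
  case (insert a X)
  have "switch (insert a X) D = switch {a} (switch X D)"
  proof -
    have "({a} - X) \<union> (X - {a}) = insert a X" using insert.hyps by auto
    then show ?thesis by (simp only: switch_switch)
  qed
  moreover have "w (switch {a} (switch X D)) c = w (switch X D) c"
    using assms(1) insert.prems by (auto simp: crossing_change_local_def)
  ultimately show ?case using insert by simp
qed

text \<open>At \<open>c\<close> itself, changing \<open>c\<close> and taking the mirror image differ by crossing changes away
  from \<open>c\<close>, so a local weight does not distinguish them.\<close>

lemma crossing_change_local_mirror:
  assumes "crossing_change_local w" "c \<in> crossings D"
  shows "w (mirror D) c = w (switch {c} D) c"
proof -
  have "mirror D = switch (crossings D - {c}) (switch {c} D)"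
    using assms(2) by (simp add: mirror_def switch_switch insert_absorb)
  then show ?thesis
    using crossing_change_local_switch[OF assms(1), of "crossings D - {c}" "switch {c} D" c] assms(2)
    by simp
qed

section \<open>Tangles in a diagram\<close>

text \<open>The positions of the classical crossings of a tangle. As crossings are vertices by
  convention, they can be read off the vertex lists.\<close>

definition flagged :: "tangle \<Rightarrow> complex set" where
  "flagged T = {p. \<exists>vs\<in>set T. (p, True) \<in> set vs}"

lemma strand_point_vertex: "strand_point vs (real k / real (length vs - 1)) = fst (vs ! k)"
  if "1 < length vs"
  using that by (simp add: strand_point_def Let_def linepath_def frac_def)

lemma strand_over_vertex:
  assumes "1 < length vs" "k < length vs"
  shows "strand_over vs (real k / real (length vs - 1)) \<longleftrightarrow> snd (vs ! k)"
  using assms by (auto simp: strand_over_def)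

lemma strand_over_obtain_vertex:
  assumes "1 < length vs" "strand_over vs s"
  obtains k where "k < length vs" "snd (vs ! k)" "s = real k / real (length vs - 1)"
  using assms by (auto simp: strand_over_def field_simps)

text \<open>Over-points in the disc correspond under \<open>\<sigma>\<close> to flagged times, and
  flags occur only at vertex times. At least two vertices per strand are required to convert vertex
  indices into times.\<close>

lemma displays_crossings:
  assumes d: "displays (raw D) \<psi> T \<sigma>" and len: "\<forall>vs\<in>set T. 1 < length vs"
  shows "crossings D \<inter> \<psi> ` square = \<psi> ` flagged T"
proof -
  define I where "I = {..<length T} \<times> {0..1::real}"
  note d' = d[unfolded displays_def Let_def, folded I_def]
  have im: "\<sigma> ` I = {x \<in> circles (raw D). curve (raw D) x \<in> \<psi> ` square}"
    using d' by blast
  have cv: "curve (raw D) (\<sigma> (j, t)) = \<psi> (strand_point (T ! j) t)"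
    and fl: "\<sigma> (j, t) \<in> over (raw D) \<longleftrightarrow> strand_over (T ! j) t"
    if "(j, t) \<in> I" for j t
    using d' that by auto
  show ?thesis
  proof (intro equalityI subsetI)
    fix p assume "p \<in> crossings D \<inter> \<psi> ` square"
    then obtain x where x: "x \<in> over (raw D)" "p = curve (raw D) x" "p \<in> \<psi> ` square"
      by (auto simp: crossings_def)
    then have "x \<in> \<sigma> ` I" using im over_raw by auto
    then obtain j t where jt: "(j, t) \<in> I" "x = \<sigma> (j, t)" by auto
    then have j: "T ! j \<in> set T" by (simp add: I_def)
    have "strand_over (T ! j) t" using fl jt x by blast
    with len j obtain k where k: "k < length (T ! j)" "snd (T ! j ! k)"
      "t = real k / real (length (T ! j) - 1)"
      using strand_over_obtain_vertex by metis
    have "p = \<psi> (fst (T ! j ! k))" using x jt cv k len j strand_point_vertex by metis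
    moreover have "(fst (T ! j ! k), True) \<in> set (T ! j)"
      using k by (metis nth_mem prod.collapse)
    ultimately show "p \<in> \<psi> ` flagged T" using j by (auto simp: flagged_def)
  next
    fix p assume "p \<in> \<psi> ` flagged T"
    then obtain q vs where q: "p = \<psi> q" "vs \<in> set T" "(q, True) \<in> set vs"
      by (auto simp: flagged_def)
    then obtain j k where jk: "j < length T" "k < length (T ! j)" "T ! j ! k = (q, True)"
      by (metis in_set_conv_nth)
    define t where "t = real k / real (length (T ! j) - 1)"
    have l: "1 < length (T ! j)" using len jk by simp
    then have jt: "(j, t) \<in> I" using jk by (auto simp: I_def t_def)
    have "\<sigma> (j, t) \<in> over (raw D)" using fl[OF jt] strand_over_vertex[OF l] jk by (simp add: t_def)
    moreover have "curve (raw D) (\<sigma> (j, t)) = p"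
      using cv[OF jt] strand_point_vertex[OF l] jk q by (simp add: t_def)
    moreover have "\<sigma> (j, t) \<in> \<sigma> ` I" using jt by blast
    ultimately show "p \<in> crossings D \<inter> \<psi> ` square"
      unfolding im by (auto simp: crossings_def)
  qed
qed

text \<open>Passing to the mirror image moves the flag of a crossing to its other branch. Pairing flagged
  vertices is enough to recognize this, because a double point of a diagram has only two preimages;
  the intersections of the edges of a tangle need not be computed.\<close>

definition answered :: "tangle \<Rightarrow> tangle \<Rightarrow> bool" where
  "answered T T' \<longleftrightarrow> map (map fst) T' = map (map fst) T \<and> (\<forall>vs\<in>set T. 1 < length vs) \<and>
    (\<forall>j<length T. \<forall>k<length (T ! j). snd (T ! j ! k) \<longrightarrow>
      (\<exists>j'<length T'. \<exists>k'<length (T' ! j').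
        (j' \<noteq> j \<or> k' \<noteq> k) \<and> fst (T' ! j' ! k') = fst (T ! j ! k) \<and> snd (T' ! j' ! k')))"

text \<open>The map \<open>\<mu>\<close> sends a vertex to the other vertex at the same point. With
  an explicit \<open>\<mu>\<close> and equality of whole vertex entries, the condition for a
  concrete tangle is settled by evaluation.\<close>

lemma answeredI:
  assumes "map (map fst) T' = map (map fst) T" "\<forall>vs\<in>set T. 1 < length vs"
    and "\<forall>j<length T. \<forall>k<length (T ! j). snd (T ! j ! k) \<longrightarrow> \<mu> (j, k) \<noteq> (j, k) \<and>
      fst (\<mu> (j, k)) < length T \<and> snd (\<mu> (j, k)) < length (T ! fst (\<mu> (j, k))) \<and>
      T' ! fst (\<mu> (j, k)) ! snd (\<mu> (j, k)) = T ! j ! k"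
  shows "answered T T'"
proof -
  have l: "length T' = length T" "\<And>i. i < length T \<Longrightarrow> length (T' ! i) = length (T ! i)"
    using assms(1) by (metis length_map, metis length_map nth_map)
  show ?thesis
    unfolding answered_def
  proof (intro conjI assms allI impI)
    fix j k assume "j < length T" "k < length (T ! j)" "snd (T ! j ! k)"
    then have "\<mu> (j, k) \<noteq> (j, k)" "fst (\<mu> (j, k)) < length T'"
      "snd (\<mu> (j, k)) < length (T' ! fst (\<mu> (j, k)))"
      "T' ! fst (\<mu> (j, k)) ! snd (\<mu> (j, k)) = T ! j ! k"
      using assms(3) l by auto
    then show "\<exists>j'<length T'. \<exists>k'<length (T' ! j'). (j' \<noteq> j \<or> k' \<noteq> k) \<and>
        fst (T' ! j' ! k') = fst (T ! j ! k) \<and> snd (T' ! j' ! k')"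
      using \<open>snd (T ! j ! k)\<close> by (metis prod.collapse)
  qed
qed

text \<open>The strand meets itself at its vertices 1 and 4, which \<open>5 - k\<close>
  exchanges.\<close>

lemma answered_kink: "answered (kink x y) (kink y x)"
  by (rule answeredI[where \<mu> = "\<lambda>(j, k). (j, 5 - k)"])
    (simp_all add: kink_def All_less_Suc)

text \<open>The two strands meet at index 1 and again at index 3 of both, so only the strand is
  exchanged.\<close>

lemma answered_bigon: "answered (bigon x y) (bigon y x)"
  by (rule answeredI[where \<mu> = "\<lambda>(j, k). (1 - j, k)"])
    (simp_all add: bigon_def All_less_Suc)

lemma answered_no_kink: "answered no_kink no_kink"
  by (rule answeredI[where \<mu> = id]) (simp_all add: no_kink_def All_less_Suc)

lemma answered_no_bigon: "answered no_bigon no_bigon"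
  by (rule answeredI[where \<mu> = id]) (simp_all add: no_bigon_def All_less_Suc)

text \<open>The table pairs the two vertices of each of the three crossings. It omits the endpoints
  of the strands, where \<open>the\<close> is unspecified; these are never flagged.\<close>

lemma answered_triangle: "answered (triangle f) (triangle (\<lambda>j k. f k j))"
  by (rule answeredI[where \<mu> =
        "\<lambda>p. the (map_of [((0,1),(1,1)), ((1,1),(0,1)), ((0,2),(2,2)), ((2,2),(0,2)),
          ((1,2),(2,1)), ((2,1),(1,2))] p)"])
    (simp_all add: triangle_def All_less_Suc)

text \<open>The table differs from that of \<open>triangle\<close> because the move reverses the
  order of the two crossings along every strand.\<close>

lemma answered_moved_triangle: "answered (moved_triangle f) (moved_triangle (\<lambda>j k. f k j))"
  by (rule answeredI[where \<mu> =
        "\<lambda>p. the (map_of [((0,1),(2,1)), ((2,1),(0,1)), ((0,2),(1,2)), ((1,2),(0,2)),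
          ((1,1),(2,2)), ((2,2),(1,1))] p)"])
    (simp_all add: moved_triangle_def All_less_Suc)

section \<open>Mirror images of Reidemeister moves\<close>

lemma strand_point_cong:
  assumes vs: "map fst vs' = map fst vs" "1 < length vs" and t: "0 \<le> t" "t \<le> 1"
  shows "strand_point vs' t = strand_point vs t"
proof -
  define u where "u = t * real (length vs - 1)"
  define k where "k = nat \<lfloor>u\<rfloor>"
  have l: "length vs' = length vs" using vs(1) by (metis length_map)
  have f: "fst (vs' ! i) = fst (vs ! i)" if "i < length vs" for i
    using vs(1) l that by (metis nth_map)
  have u0: "0 \<le> u" "u \<le> real (length vs - 1)"
    using t by (simp_all add: u_def mult_left_le_one_le)
  have ku: "real k \<le> u" using u0 by (simp add: k_def)
  with u0 vs(2) have k: "k < length vs" by linarith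
  have sp: "strand_point xs t = linepath (fst (xs ! k)) (fst (xs ! Suc k)) (frac u)"
    if "length xs = length vs" for xs
    unfolding strand_point_def Let_def that u_def k_def ..
  show ?thesis
  proof (cases "Suc k < length vs")
    case True
    then show ?thesis using sp[OF l] sp[OF refl] f k by simp
  next
    \<comment> \<open>Here \<open>u\<close> is the index of the last vertex. The entries past the
      end are unspecified and may differ between the two lists, but \<open>frac u = 0\<close> gives
      them weight 0.\<close>
    case False
    then have "real k = real (length vs - 1)" using k by linarith
    then have "u = real k" using ku u0 by linarith
    then have "frac u = 0" by (simp add: frac_def)
    then show ?thesis using sp[OF l] sp[OF refl] f k by (simp add: linepath_def)
  qed
qed

text \<open>The curve is unchanged, so \<open>\<sigma>\<close> and the strand points carry over. For
  the flags, \<open>answered T T'\<close> shows that every new over-point is flagged in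
  \<open>T'\<close>, and \<open>answered T' T\<close> gives the converse.\<close>

lemma displays_mirror:
  assumes d: "displays (raw D) \<psi> T \<sigma>" and TT': "answered T T'" "answered T' T"
  shows "displays (raw (mirror D)) \<psi> T' \<sigma>"
proof -
  define I where "I = {..<length T} \<times> {0..1::real}"
  \<comment> \<open>The parameter at which strand \<open>j\<close> reaches its \<open>k\<close>-th
    vertex.\<close>
  define vt where "vt j k = (j, real k / real (length (T ! j) - 1))" for j k
  note d' = d[unfolded displays_def Let_def, folded I_def]
  have injs: "inj_on \<sigma> I" and im: "\<sigma> ` I = {x \<in> circles (raw D). curve (raw D) x \<in> \<psi> ` square}"
    using d' by blast+
  have cv: "curve (raw D) (\<sigma> (j, t)) = \<psi> (strand_point (T ! j) t)"
    and fl: "\<sigma> (j, t) \<in> over (raw D) \<longleftrightarrow> strand_over (T ! j) t"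
    if "(j, t) \<in> I" for j t
    using d' that by auto
  have maps: "map (map fst) T' = map (map fst) T" using TT' by (simp add: answered_def)
  then have lT: "length T' = length T" by (metis length_map)
  have strand: "length (T' ! j) = length (T ! j)" "1 < length (T ! j)"
    "\<And>k. k < length (T ! j) \<Longrightarrow> fst (T' ! j ! k) = fst (T ! j ! k)" if "j < length T" for j
  proof -
    have e: "map fst (T' ! j) = map fst (T ! j)" using that maps lT by (metis nth_map)
    then show "length (T' ! j) = length (T ! j)" by (metis length_map)
    then show "fst (T' ! j ! k) = fst (T ! j ! k)" if "k < length (T ! j)" for k
      using e that by (metis nth_map)
    show "1 < length (T ! j)" using TT' that by (simp add: answered_def)
  qed
  have vtI: "vt j k \<in> I" and vtc: "curve (raw D) (\<sigma> (vt j k)) = \<psi> (fst (T ! j ! k))"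
    and vto: "\<sigma> (vt j k) \<in> over (raw D) \<longleftrightarrow> snd (T ! j ! k)"
    if "j < length T" "k < length (T ! j)" for j k
  proof -
    have "real k \<le> real (length (T ! j) - 1)" using that(2) by linarith
    then show "vt j k \<in> I" using that strand(2)[OF that(1)] by (simp add: I_def vt_def)
    then show "curve (raw D) (\<sigma> (vt j k)) = \<psi> (fst (T ! j ! k))"
      "\<sigma> (vt j k) \<in> over (raw D) \<longleftrightarrow> snd (T ! j ! k)"
      using cv fl strand(2)[OF that(1)] that strand_point_vertex strand_over_vertex
      unfolding vt_def by metis+
  qed
  have vtinj: "vt j k \<noteq> vt j' k'"
    if "j < length T" "k < length (T ! j)" "j' \<noteq> j \<or> k' \<noteq> k" for j k j' k'
  proof (cases "j' = j")
    case True
    have "real (length (T ! j) - 1) \<noteq> 0" using strand(2)[OF that(1)] by simp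
    then show ?thesis using that True by (simp add: vt_def)
  qed (simp add: vt_def)
  have circ: "\<sigma> p \<in> circles (raw D)" if "p \<in> I" for p using that im by blast
  have vertex: "\<exists>k<length (T ! j). snd (U ! j ! k) \<and> (j, t) = vt j k"
    if "(j, t) \<in> I" "strand_over (U ! j) t" "length (U ! j) = length (T ! j)" for j t U
  proof -
    have "1 < length (U ! j)" using that strand(2)[of j] by (simp add: I_def)
    from strand_over_obtain_vertex[OF this that(2)] show ?thesis
      unfolding vt_def that(3) by metis
  qed
  have new: "\<sigma> (j, t) \<in> over (raw (mirror D)) \<longleftrightarrow> strand_over (T' ! j) t"
    if jt: "(j, t) \<in> I" for j t
  proof
    have j: "j < length T" using jt by (simp add: I_def)
    assume "\<sigma> (j, t) \<in> over (raw (mirror D))"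
    then have no: "\<sigma> (j, t) \<notin> over (raw D)" and "curve (raw D) (\<sigma> (j, t)) \<in> crossings D"
      by (simp_all add: over_mirror)
    then obtain y where y: "y \<in> over (raw D)" "curve (raw D) y = curve (raw D) (\<sigma> (j, t))"
      by (auto simp: crossings_def)
    then have "y \<in> \<sigma> ` I" using im jt over_raw by auto
    then obtain j1 t1 where 1: "(j1, t1) \<in> I" "y = \<sigma> (j1, t1)" by auto
    then have j1: "j1 < length T" by (simp add: I_def)
    obtain k1 where k1: "k1 < length (T ! j1)" "snd (T ! j1 ! k1)" "(j1, t1) = vt j1 k1"
      using vertex[OF 1(1), of T] fl[OF 1(1)] 1 y by blast
    then obtain j2 k2 where 2: "j2 < length T" "k2 < length (T ! j2)" "j2 \<noteq> j1 \<or> k2 \<noteq> k1"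
      "fst (T' ! j2 ! k2) = fst (T ! j1 ! k1)" "snd (T' ! j2 ! k2)"
      using TT'(1) j1 lT strand(1) unfolding answered_def by metis
    have "y \<noteq> \<sigma> (vt j2 k2)"
      using vtinj[OF j1 k1(1) 2(3)] k1(3) 1 vtI[OF 2(1,2)] injs by (metis inj_onD)
    moreover have "curve (raw D) y = curve (raw D) (\<sigma> (vt j2 k2))"
      using vtc[OF 2(1,2)] vtc[OF j1 k1(1)] 1 k1 2 strand(3) by metis
    moreover have "y \<noteq> \<sigma> (j, t)" using no y by blast
    \<comment> \<open>The point has two preimages: \<open>y\<close>, which is over in
      \<open>D\<close>, and the answering vertex. As \<open>\<sigma> (j, t)\<close> is not
      \<open>y\<close>, it must be the latter.\<close>
    ultimately have "\<sigma> (j, t) = \<sigma> (vt j2 k2)"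
      using preimage_cases[of y D "\<sigma> (vt j2 k2)" "\<sigma> (j, t)"] circ vtI[OF 2(1,2)] jt y over_raw
      by metis
    then have "(j, t) = vt j2 k2" using injs jt vtI[OF 2(1,2)] by (metis inj_onD)
    then have "j = j2" "t = real k2 / real (length (T' ! j) - 1)"
      using strand(1) 2 by (simp_all add: vt_def)
    then show "strand_over (T' ! j) t"
      using strand_over_vertex[of "T' ! j" k2] strand(1,2)[OF j] 2 by simp
  next
    have j: "j < length T" using jt by (simp add: I_def)
    assume "strand_over (T' ! j) t"
    then obtain k where k: "k < length (T ! j)" "snd (T' ! j ! k)" "(j, t) = vt j k"
      using vertex[OF jt, of T'] strand(1)[OF j] by blast
    then obtain j2 k2 where 2: "j2 < length T" "k2 < length (T ! j2)" "j2 \<noteq> j \<or> k2 \<noteq> k"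
      "fst (T ! j2 ! k2) = fst (T' ! j ! k)" "snd (T ! j2 ! k2)"
      using TT'(2) j lT strand(1) unfolding answered_def by metis
    have o: "\<sigma> (vt j2 k2) \<in> over (raw D)" using vto 2 by blast
    moreover have c: "curve (raw D) (\<sigma> (vt j2 k2)) = curve (raw D) (\<sigma> (j, t))"
      using vtc[OF 2(1,2)] vtc[OF j k(1)] k 2 strand(3)[OF j] by metis
    moreover have "\<sigma> (vt j2 k2) \<noteq> \<sigma> (j, t)"
      using vtinj[OF j k(1) 2(3)] k(3) jt vtI[OF 2(1,2)] injs by (metis inj_onD)
    ultimately have "\<sigma> (j, t) \<notin> over (raw D)"
      using over_unique circ[OF vtI[OF 2(1,2)]] circ[OF jt] by metis
    moreover have "curve (raw D) (\<sigma> (j, t)) \<in> crossings D"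
      using o c unfolding crossings_def by (metis imageI)
    ultimately show "\<sigma> (j, t) \<in> over (raw (mirror D))"
      using circ[OF jt] by (simp add: over_mirror)
  qed
  have same: "strand_point (T' ! j) t = strand_point (T ! j) t" if "(j, t) \<in> I" for j t
    using that strand[of j] by (intro strand_point_cong) (simp_all add: I_def list_eq_iff_nth_eq)
  show ?thesis
    using d' new same unfolding displays_def Let_def lT I_def[symmetric] by auto
qed

text \<open>With equally many strands, \<open>\<sigma>\<close> has the same domain for both tangles,
  so the same points of the circles are mapped into the disc before and after. This is needed
  because \<open>replaces\<close> compares the diagrams only at points that start outside the
  disc.\<close>

lemma replaces_crossings_outside:
  assumes r: "replaces \<psi> T T' D D'" and len: "length T = length T'"
  shows "crossings D' - \<psi> ` square = crossings D - \<psi> ` square"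
proof -
  from r obtain \<sigma> where d: "displays (raw D) \<psi> T \<sigma>" "displays (raw D') \<psi> T' \<sigma>"
    and n: "num_components (raw D') = num_components (raw D)"
    and out: "\<And>x. x \<in> circles (raw D) \<Longrightarrow> curve (raw D) x \<notin> \<psi> ` square \<Longrightarrow>
      curve (raw D') x = curve (raw D) x \<and> (x \<in> over (raw D') \<longleftrightarrow> x \<in> over (raw D))"
    unfolding replaces_def by blast
  have c: "circles (raw D') = circles (raw D)" using n by (simp add: circles_def)
  have "{x \<in> circles (raw D). curve (raw D) x \<in> \<psi> ` square} =
      {x \<in> circles (raw D'). curve (raw D') x \<in> \<psi> ` square}"
    using d len unfolding displays_def Let_def by metis
  then have inside: "curve (raw D') x \<in> \<psi> ` square \<longleftrightarrow> curve (raw D) x \<in> \<psi> ` square"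
    if "x \<in> circles (raw D)" for x
    using that c by blast
  show ?thesis
  proof (intro equalityI subsetI)
    fix p assume "p \<in> crossings D' - \<psi> ` square"
    then obtain x where x: "x \<in> over (raw D')" "p = curve (raw D') x" "p \<notin> \<psi> ` square"
      by (auto simp: crossings_def)
    have "x \<in> circles (raw D)" using over_raw[OF x(1)] c by simp
    then show "p \<in> crossings D - \<psi> ` square"
      using x inside out unfolding crossings_def by (metis DiffI imageI)
  next
    fix p assume "p \<in> crossings D - \<psi> ` square"
    then obtain x where x: "x \<in> over (raw D)" "p = curve (raw D) x" "p \<notin> \<psi> ` square"
      by (auto simp: crossings_def)
    have "x \<in> circles (raw D)" using over_raw[OF x(1)] by simp
    then show "p \<in> crossings D' - \<psi> ` square"
      using x out unfolding crossings_def by (metis DiffI imageI)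
  qed
qed

lemma replaces_mirror:
  assumes r: "replaces \<psi> T T' D D'" and len: "length T = length T'"
    and "answered T U" "answered U T" "answered T' U'" "answered U' T'"
  shows "replaces \<psi> U U' (mirror D) (mirror D')"
proof -
  have c: "circles (raw D') = circles (raw D)" using r by (simp add: replaces_def circles_def)
  have cr: "p \<in> crossings D' \<longleftrightarrow> p \<in> crossings D" if "p \<notin> \<psi> ` square" for p
    using replaces_crossings_outside[OF r len] that by blast
  have "x \<in> over (raw (mirror D')) \<longleftrightarrow> x \<in> over (raw (mirror D))"
    if "x \<in> circles (raw D)" "curve (raw D) x \<notin> \<psi> ` square" for x
    using r that cr c by (simp add: over_mirror replaces_def)
  then show ?thesis
    using r displays_mirror assms(3-6) unfolding replaces_def mirror_simps by blast
qed

lemma replaces_kink_mirror: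
  "replaces \<psi> (kink x y) no_kink D D' \<Longrightarrow> replaces \<psi> (kink y x) no_kink (mirror D) (mirror D')"
  by (rule replaces_mirror[OF _ _ answered_kink answered_kink answered_no_kink answered_no_kink])
    (simp_all add: kink_def no_kink_def)

lemma replaces_bigon_mirror:
  "replaces \<psi> (bigon x y) no_bigon D D' \<Longrightarrow> replaces \<psi> (bigon y x) no_bigon (mirror D) (mirror D')"
  by (rule replaces_mirror[OF _ _ answered_bigon answered_bigon answered_no_bigon answered_no_bigon])
    (simp_all add: bigon_def no_bigon_def)

lemma replaces_triangle_mirror:
  assumes "replaces \<psi> (triangle f) (moved_triangle f) D D'"
  shows "replaces \<psi> (triangle (\<lambda>j k. f k j)) (moved_triangle (\<lambda>j k. f k j)) (mirror D) (mirror D')"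
proof (rule replaces_mirror[OF assms])
  show "length (triangle f) = length (moved_triangle f)"
    by (simp add: triangle_def moved_triangle_def)
  show "answered (triangle (\<lambda>j k. f k j)) (triangle f)"
    using answered_triangle[of "\<lambda>j k. f k j"] by simp
  show "answered (moved_triangle (\<lambda>j k. f k j)) (moved_triangle f)"
    using answered_moved_triangle[of "\<lambda>j k. f k j"] by simp
qed (rule answered_triangle answered_moved_triangle)+

text \<open>Only the strand indices 0, 1, 2 enter the pictures; the reversed heights of an RIII move
  are controlled only there.\<close>

lemma triangle_cong:
  assumes "\<And>j k. j < 3 \<Longrightarrow> k < 3 \<Longrightarrow> f j k = g j k"
  shows "triangle f = triangle g" "moved_triangle f = moved_triangle g"
proof -
  have "f 0 1 = g 0 1" "f 0 2 = g 0 2" "f 1 0 = g 1 0" "f 1 2 = g 1 2" "f 2 0 = g 2 0" "f 2 1 = g 2 1"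
    by (rule assms; simp)+
  then show "triangle f = triangle g" "moved_triangle f = moved_triangle g"
    by (simp_all only: triangle_def moved_triangle_def)
qed

lemma RIII_mirror:
  assumes "RIII \<psi> D D'"
  shows "RIII \<psi> (mirror D) (mirror D')"
proof -
  from assms obtain height :: "nat \<Rightarrow> nat" where inj: "inj_on height {..<3}"
    and r: "replaces \<psi> (triangle (\<lambda>j k. height j > height k))
      (moved_triangle (\<lambda>j k. height j > height k)) D D'"
    unfolding RIII_def Let_def by blast
  \<comment> \<open>The mirror image reverses the order of the heights. The sum bounds all three of
    them, so the truncated subtraction in \<open>height'\<close> loses nothing.\<close>
  define N where "N = height 0 + height 1 + height 2"
  define height' where "height' j = N - height j" for j
  have le: "height j \<le> N" if "j < 3" for j
  proof -
    have "j = 0 \<or> j = 1 \<or> j = 2" using that by auto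
    then show ?thesis by (auto simp: N_def)
  qed
  have flip: "height' j > height' k \<longleftrightarrow> height k > height j" if "j < 3" "k < 3" for j k
    using le[OF that(1)] le[OF that(2)] unfolding height'_def by linarith
  have "inj_on height' {..<3}"
  proof (rule inj_onI)
    fix j k :: nat assume jk: "j \<in> {..<3}" "k \<in> {..<3}" "height' j = height' k"
    then have "height j \<le> N" "height k \<le> N" using le by simp_all
    then have "height j = height k" using jk(3) unfolding height'_def by linarith
    then show "j = k" using inj jk by (meson inj_onD)
  qed
  moreover have "triangle (\<lambda>j k. height' j > height' k) = triangle (\<lambda>j k. height k > height j)"
    by (rule triangle_cong(1)) (rule flip)
  moreover have "moved_triangle (\<lambda>j k. height' j > height' k) =
      moved_triangle (\<lambda>j k. height k > height j)"
    by (rule triangle_cong(2)) (rule flip)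
  ultimately show ?thesis
    using replaces_triangle_mirror[OF r] unfolding RIII_def Let_def by (intro exI conjI) (assumption, simp only:)
qed

lemma SV_mirror:
  assumes "SV \<psi> D D'"
  shows "SV \<psi> (mirror D) (mirror D')"
proof -
  from assms obtain a b :: nat where p: "(a, b) \<in> {(1, 2), (2, 1)}"
    and r: "replaces \<psi> (triangle (\<lambda>j k. (j, k) = (a, b))) (moved_triangle (\<lambda>j k. (j, k) = (a, b))) D D'"
    unfolding SV_def Let_def by auto
  have "(\<lambda>j k. (k, j) = (a, b)) = (\<lambda>j k. (j, k) = (b, a))" by auto
  then have "replaces \<psi> (triangle (\<lambda>j k. (j, k) = (b, a)))
      (moved_triangle (\<lambda>j k. (j, k) = (b, a))) (mirror D) (mirror D')"
    using replaces_triangle_mirror[OF r] by simp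
  moreover have "(b, a) \<in> {(1, 2), (2, 1)}" using p by auto
  ultimately show ?thesis unfolding SV_def Let_def by blast
qed

lemma local_move_mirror:
  assumes "local_move \<psi> D D'"
  shows "local_move \<psi> (mirror D) (mirror D')"
proof -
  have "RI \<psi> D D' \<Longrightarrow> RI \<psi> (mirror D) (mirror D')"
    unfolding RI_def by (elim exE conjE, intro exI conjI, erule not_sym, erule replaces_kink_mirror)
  moreover have "RII \<psi> D D' \<Longrightarrow> RII \<psi> (mirror D) (mirror D')"
    unfolding RII_def by (elim exE conjE, intro exI conjI, erule not_sym, erule replaces_bigon_mirror)
  moreover have "VRI \<psi> D D' \<Longrightarrow> VRI \<psi> (mirror D) (mirror D')"
    unfolding VRI_def by (rule replaces_kink_mirror)
  moreover have "VRII \<psi> D D' \<Longrightarrow> VRII \<psi> (mirror D) (mirror D')"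
    unfolding VRII_def by (rule replaces_bigon_mirror)
  moreover have "VRIII \<psi> D D' \<Longrightarrow> VRIII \<psi> (mirror D) (mirror D')"
    unfolding VRIII_def by (rule replaces_triangle_mirror)
  ultimately show ?thesis
    using assms RIII_mirror SV_mirror unfolding local_move_def by blast
qed

section \<open>Plane isotopies\<close>

lemma isotopic_to_id_homeomorphism:
  assumes "isotopic_to_id S h"
  shows "\<exists>h'. homeomorphism S S h h'"
  using homotopic_with_imp_property[OF assms[unfolded isotopic_to_id_def]] by blast

text \<open>Glues the reparametrizations of the individual components into one bijection of all
  circles.\<close>

lemma plane_isotopyE:
  assumes "plane_isotopy h D D'"
  obtains r where "inj h" "circles (raw D') = circles (raw D)"
    "bij_betw r (circles (raw D)) (circles (raw D))"
    "\<And>x. x \<in> circles (raw D) \<Longrightarrow> curve (raw D') x = h (curve (raw D) (r x))"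
    "\<And>x. x \<in> circles (raw D) \<Longrightarrow> x \<in> over (raw D') \<longleftrightarrow> r x \<in> over (raw D)"
proof -
  from assms obtain \<rho> where h: "isotopic_to_id UNIV h"
    and n: "num_components (raw D') = num_components (raw D)"
    and \<rho>: "\<And>i. i \<in> {1..num_components (raw D)} \<Longrightarrow> isotopic_to_id (sphere 0 1) (\<rho> i)"
    and eq: "\<And>i z. i \<in> {1..num_components (raw D)} \<Longrightarrow> z \<in> sphere 0 1 \<Longrightarrow>
      curve (raw D') (i, z) = h (curve (raw D) (i, \<rho> i z)) \<and>
      ((i, z) \<in> over (raw D') \<longleftrightarrow> (i, \<rho> i z) \<in> over (raw D))"
    unfolding plane_isotopy_def by blast
  have "inj h"
    using isotopic_to_id_homeomorphism[OF h] plane_homeo_inj unfolding plane_homeo_def by blast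
  moreover have \<rho>_bij: "bij_betw (\<rho> i) (sphere 0 1) (sphere 0 1)"
    if i: "i \<in> {1..num_components (raw D)}" for i
  proof -
    obtain \<rho>' where "homeomorphism (sphere 0 1) (sphere 0 1) (\<rho> i) \<rho>'"
      using isotopic_to_id_homeomorphism[OF \<rho>[OF i]] by blast
    then show ?thesis
      by (intro bij_betw_byWitness[where f' = \<rho>']) (auto simp: homeomorphism_def)
  qed
  have "bij_betw (\<lambda>(i, z). (i, \<rho> i z)) (circles (raw D)) (circles (raw D))"
    unfolding bij_betw_def
  proof
    show "inj_on (\<lambda>(i, z). (i, \<rho> i z)) (circles (raw D))"
    proof (rule inj_onI, clarsimp simp: circles_def)
      fix i z z' assume "Suc 0 \<le> i" "i \<le> num_components (raw D)" "cmod z = 1" "cmod z' = 1"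
        "\<rho> i z = \<rho> i z'"
      then show "z = z'"
        using \<rho>_bij[of i] unfolding bij_betw_def by (auto dest: inj_onD)
    qed
    have "(\<lambda>(i, z). (i, \<rho> i z)) ` circles (raw D) =
        (SIGMA i:{1..num_components (raw D)}. \<rho> i ` sphere 0 1)"
      unfolding circles_def by force
    also have "\<dots> = circles (raw D)"
      unfolding circles_def using \<rho>_bij by (intro Sigma_cong) (simp_all add: bij_betw_def)
    finally show "(\<lambda>(i, z). (i, \<rho> i z)) ` circles (raw D) = circles (raw D)" .
  qed
  moreover have "circles (raw D') = circles (raw D)" using n by (simp add: circles_def)
  moreover have "curve (raw D') x = h (curve (raw D) ((\<lambda>(i, z). (i, \<rho> i z)) x)) \<and>
      (x \<in> over (raw D') \<longleftrightarrow> (\<lambda>(i, z). (i, \<rho> i z)) x \<in> over (raw D))"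
    if "x \<in> circles (raw D)" for x
  proof -
    obtain i z where "x = (i, z)" "i \<in> {1..num_components (raw D)}" "z \<in> sphere 0 1"
      using \<open>x \<in> circles (raw D)\<close> unfolding circles_def by blast
    then show ?thesis using eq by simp
  qed
  ultimately show thesis
    using that by blast
qed

lemma plane_isotopy_crossings:
  assumes "plane_isotopy h D D'"
  shows "inj h" "crossings D' = h ` crossings D"
proof -
  from assms obtain r where h: "inj h" and c: "circles (raw D') = circles (raw D)"
    and r: "bij_betw r (circles (raw D)) (circles (raw D))"
    and cv: "\<And>x. x \<in> circles (raw D) \<Longrightarrow> curve (raw D') x = h (curve (raw D) (r x))"
    and ov: "\<And>x. x \<in> circles (raw D) \<Longrightarrow> x \<in> over (raw D') \<longleftrightarrow> r x \<in> over (raw D)"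
    by (rule plane_isotopyE) blast
  show "inj h" by fact
  show "crossings D' = h ` crossings D"
  proof (intro equalityI subsetI)
    fix p assume "p \<in> crossings D'"
    then obtain x where x: "x \<in> over (raw D')" "p = curve (raw D') x" by (auto simp: crossings_def)
    then have "x \<in> circles (raw D)" using over_raw c by blast
    then show "p \<in> h ` crossings D" using x cv ov by (auto simp: crossings_def)
  next
    fix p assume "p \<in> h ` crossings D"
    then obtain y where y: "y \<in> over (raw D)" "p = h (curve (raw D) y)" by (auto simp: crossings_def)
    then obtain x where "x \<in> circles (raw D)" "y = r x"
      using over_raw r by (metis bij_betw_def imageE)
    then show "p \<in> crossings D'" using y cv ov unfolding crossings_def by (metis imageI)
  qed
qed

text \<open>The same \<open>h\<close> and \<open>r\<close> serve. Since \<open>h\<close> is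
  injective and maps crossings onto crossings, a point is a crossing of \<open>D\<close> exactly if
  its image is one of \<open>D'\<close>.\<close>

lemma plane_isotopy_mirror:
  assumes "plane_isotopy h D D'"
  shows "plane_isotopy h (mirror D) (mirror D')"
proof -
  from assms obtain r where h: "isotopic_to_id UNIV h"
    and n: "num_components (raw D') = num_components (raw D)"
    and r: "\<And>i. i \<in> {1..num_components (raw D)} \<Longrightarrow> isotopic_to_id (sphere 0 1) (r i)"
    and eq: "\<And>i z. i \<in> {1..num_components (raw D)} \<Longrightarrow> z \<in> sphere 0 1 \<Longrightarrow>
      curve (raw D') (i, z) = h (curve (raw D) (i, r i z)) \<and>
      ((i, z) \<in> over (raw D') \<longleftrightarrow> (i, r i z) \<in> over (raw D))"
    unfolding plane_isotopy_def by blast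
  have "(i, z) \<in> over (raw (mirror D')) \<longleftrightarrow> (i, r i z) \<in> over (raw (mirror D))"
    if i: "i \<in> {1..num_components (raw D)}" and z: "z \<in> sphere 0 1" for i z
  proof -
    have "r i z \<in> sphere 0 1"
      using isotopic_to_id_homeomorphism[OF r[OF i]] z by (auto simp: homeomorphism_def)
    then have "(i, z) \<in> circles (raw D')" "(i, r i z) \<in> circles (raw D)"
      using i z n by (simp_all add: circles_def)
    then show ?thesis
      using eq[OF i z] plane_isotopy_crossings[OF assms]
      by (simp add: over_mirror inj_image_mem_iff)
  qed
  then show ?thesis
    unfolding plane_isotopy_def mirror_simps using h n r eq by blast
qed

lemma reidemeister_step_mirror:
  "reidemeister_step D D' \<Longrightarrow> reidemeister_step (mirror D) (mirror D')"
  unfolding reidemeister_step_def using plane_isotopy_mirror local_move_mirror by blast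

section \<open>Invariant sums over crossings\<close>

lemma RI_crossings:
  assumes "RI \<psi> D D'"
  shows "crossings D \<inter> \<psi> ` square = {\<psi> 0}" "crossings D' \<inter> \<psi> ` square = {}"
    "crossings D' - \<psi> ` square = crossings D - \<psi> ` square"
proof -
  from assms obtain x y where xy: "x \<noteq> y" and r: "replaces \<psi> (kink x y) no_kink D D'"
    unfolding RI_def by (elim exE conjE)
  from r obtain \<sigma> where d: "displays (raw D) \<psi> (kink x y) \<sigma>" "displays (raw D') \<psi> no_kink \<sigma>"
    unfolding replaces_def by blast
  \<comment> \<open>Since \<open>x \<noteq> y\<close>, exactly one of the two visits to the origin
    is flagged.\<close>
  have "flagged (kink x y) = {0}" "flagged no_kink = {}"
    using xy by (auto simp: flagged_def kink_def no_kink_def Complex_eq_0)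
  then show "crossings D \<inter> \<psi> ` square = {\<psi> 0}" "crossings D' \<inter> \<psi> ` square = {}"
    using displays_crossings[OF d(1)] displays_crossings[OF d(2)]
    by (simp_all add: kink_def no_kink_def)
  show "crossings D' - \<psi> ` square = crossings D - \<psi> ` square"
    by (rule replaces_crossings_outside[OF r]) (simp add: kink_def no_kink_def)
qed

lemma RII_crossings:
  assumes "RII \<psi> D D'"
  shows "crossings D \<inter> \<psi> ` square = {\<psi> (Complex (-1) 0), \<psi> (Complex 1 0)}"
    "crossings D' \<inter> \<psi> ` square = {}"
    "crossings D' - \<psi> ` square = crossings D - \<psi> ` square"
proof -
  from assms obtain x y where xy: "x \<noteq> y" and r: "replaces \<psi> (bigon x y) no_bigon D D'"
    unfolding RII_def by (elim exE conjE)
  from r obtain \<sigma> where d: "displays (raw D) \<psi> (bigon x y) \<sigma>" "displays (raw D') \<psi> no_bigon \<sigma>"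
    unfolding replaces_def by blast
  have "flagged (bigon x y) = {Complex (-1) 0, Complex 1 0}" "flagged no_bigon = {}"
    using xy by (auto simp: flagged_def bigon_def no_bigon_def)
  then show "crossings D \<inter> \<psi> ` square = {\<psi> (Complex (-1) 0), \<psi> (Complex 1 0)}"
    "crossings D' \<inter> \<psi> ` square = {}"
    using displays_crossings[OF d(1)] displays_crossings[OF d(2)]
    by (simp_all add: bigon_def no_bigon_def)
  show "crossings D' - \<psi> ` square = crossings D - \<psi> ` square"
    by (rule replaces_crossings_outside[OF r]) (simp add: bigon_def no_bigon_def)
qed

lemma triangle_move_crossings:
  assumes r: "replaces \<psi> (triangle f) (moved_triangle f) D D'"
  shows "crossings D \<inter> \<psi> ` square = \<psi> ` flagged (triangle f)"
    "crossings D' \<inter> \<psi> ` square = \<psi> ` flagged (moved_triangle f)"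
    "crossings D' - \<psi> ` square = crossings D - \<psi> ` square"
proof -
  from r obtain \<sigma> where d: "displays (raw D) \<psi> (triangle f) \<sigma>"
    "displays (raw D') \<psi> (moved_triangle f) \<sigma>"
    unfolding replaces_def by blast
  show "crossings D \<inter> \<psi> ` square = \<psi> ` flagged (triangle f)"
    by (rule displays_crossings[OF d(1)]) (simp add: triangle_def)
  show "crossings D' \<inter> \<psi> ` square = \<psi> ` flagged (moved_triangle f)"
    by (rule displays_crossings[OF d(2)]) (simp add: moved_triangle_def)
  show "crossings D' - \<psi> ` square = crossings D - \<psi> ` square"
    by (rule replaces_crossings_outside[OF r]) (simp add: triangle_def moved_triangle_def)
qed

lemma flagged_triangle:
  "flagged (triangle f) =
    (if f 0 1 \<or> f 1 0 then {Complex (-1) (-1)} else {}) \<union>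
    (if f 0 2 \<or> f 2 0 then {Complex 1 (-1)} else {}) \<union>
    (if f 1 2 \<or> f 2 1 then {0} else {})"
  "flagged (moved_triangle f) =
    (if f 0 1 \<or> f 1 0 then {Complex 1 1} else {}) \<union>
    (if f 0 2 \<or> f 2 0 then {Complex (-1) 1} else {}) \<union>
    (if f 1 2 \<or> f 2 1 then {0} else {})"
  by (auto simp: flagged_def triangle_def moved_triangle_def Complex_eq_0)

text \<open>The disc of a move splits the sum, and only the few crossings inside need comparison.
  The conditions are listed singly because \<open>weight_function\<close> would include locality
  under crossing changes, whereas the summand of the polynomial depends on \<open>link_of D\<close>,
  which a crossing change may alter.\<close>

lemma sum_crossings_step:
  fixes \<Phi> :: "'g::ab_group_add weight"
  assumes unv: "uninvolved_preserved \<Phi>" and R3: "RIII_preserved \<Phi>" and sv: "SV_preserved \<Phi>"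
    and R1: "\<And>\<psi> D D'. RI \<psi> D D' \<Longrightarrow> \<Phi> D (\<psi> 0) = 0"
    and R2: "\<And>\<psi> D D'. RII \<psi> D D' \<Longrightarrow> \<Phi> D (\<psi> (Complex 1 0)) = - \<Phi> D (\<psi> (Complex (-1) 0))"
    and step: "reidemeister_step D D'"
  shows "sum (\<Phi> D) (crossings D) = sum (\<Phi> D') (crossings D')"
  using step unfolding reidemeister_step_def
proof (elim disjE exE)
  fix h assume iso: "plane_isotopy h D D'"
  have "sum (\<Phi> D') (crossings D') = (\<Sum>c\<in>crossings D. \<Phi> D' (h c))"
    using plane_isotopy_crossings[OF iso] by (simp add: sum.reindex inj_on_subset)
  also have "\<dots> = sum (\<Phi> D) (crossings D)"
    using unv iso by (intro sum.cong) (auto simp: uninvolved_preserved_def)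
  finally show ?thesis by simp
next
  fix \<psi> assume mv: "local_move \<psi> D D'"
  have reduce: ?thesis
    if out: "crossings D' - \<psi> ` square = crossings D - \<psi> ` square"
      and ins: "sum (\<Phi> D) (crossings D \<inter> \<psi> ` square) = sum (\<Phi> D') (crossings D' \<inter> \<psi> ` square)"
  proof -
    have "sum (\<Phi> D') (crossings D - \<psi> ` square) = sum (\<Phi> D) (crossings D - \<psi> ` square)"
      using unv mv by (intro sum.cong) (auto simp: uninvolved_preserved_def)
    then show ?thesis
      using sum.Int_Diff[of "crossings D" "\<Phi> D" "\<psi> ` square"]
        sum.Int_Diff[of "crossings D'" "\<Phi> D'" "\<psi> ` square"] out ins by simp
  qed
  have virtual: ?thesis
    if "replaces \<psi> T T' D D'" "length T = length T'" "flagged T = {}" "flagged T' = {}"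
      "\<forall>vs\<in>set T. 1 < length vs" "\<forall>vs\<in>set T'. 1 < length vs" for T T'
  proof (rule reduce)
    show "crossings D' - \<psi> ` square = crossings D - \<psi> ` square"
      by (rule replaces_crossings_outside) fact+
    show "sum (\<Phi> D) (crossings D \<inter> \<psi> ` square) = sum (\<Phi> D') (crossings D' \<inter> \<psi> ` square)"
      using that displays_crossings unfolding replaces_def by (metis image_empty sum.empty)
  qed
  have inj: "inj \<psi>"
    using mv plane_homeo_inj
    unfolding local_move_def RI_def RII_def RIII_def VRI_def VRII_def VRIII_def SV_def
      replaces_def Let_def by blast
  show ?thesis
    using mv unfolding local_move_def
  proof (elim disjE)
    assume "RI \<psi> D D'"
    then show ?thesis using RI_crossings R1 by (intro reduce) simp_all
  next
    assume m: "RII \<psi> D D'"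
    \<comment> \<open>Distinctness ensures that both summands of the cancelling pair occur in the
      sum over a set.\<close>
    have "\<psi> (Complex (-1) 0) \<noteq> \<psi> (Complex 1 0)" by (simp add: inj_eq[OF inj])
    then show ?thesis using RII_crossings[OF m] R2[OF m] by (intro reduce) simp_all
  next
    assume m: "RIII \<psi> D D'"
    then obtain height :: "nat \<Rightarrow> nat" where inj_h: "inj_on height {..<3}"
      and r: "replaces \<psi> (triangle (\<lambda>j k. height j > height k))
        (moved_triangle (\<lambda>j k. height j > height k)) D D'"
      unfolding RIII_def Let_def by blast
    \<comment> \<open>Distinct heights make each of the three crossings classical, so all of them
      are flagged.\<close>
    have "height 0 \<noteq> height 1" "height 0 \<noteq> height 2" "height 1 \<noteq> height 2"
      using inj_h by (auto dest: inj_onD)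
    then have "height 0 > height 1 \<or> height 1 > height 0" "height 0 > height 2 \<or> height 2 > height 0"
      "height 1 > height 2 \<or> height 2 > height 1"
      by linarith+
    then have fl: "flagged (triangle (\<lambda>j k. height j > height k)) = {Complex (-1) (-1), Complex 1 (-1), 0}"
      "flagged (moved_triangle (\<lambda>j k. height j > height k)) = {Complex 1 1, Complex (-1) 1, 0}"
      unfolding flagged_triangle by (simp_all only: if_True) auto
    have d: "distinct (map \<psi> [Complex (-1) (-1), Complex 1 (-1), 0])"
      "distinct (map \<psi> [Complex 1 1, Complex (-1) 1, 0])"
      using inj by (simp_all add: distinct_map inj_eq Complex_eq_0)
    have "sum (\<Phi> D) (\<psi> ` {Complex (-1) (-1), Complex 1 (-1), 0}) =
        sum (\<Phi> D') (\<psi> ` {Complex 1 1, Complex (-1) 1, 0})"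
      using d R3 m by (simp add: RIII_preserved_def)
    then show ?thesis using triangle_move_crossings[OF r] fl by (intro reduce) simp_all
  next
    assume "VRI \<psi> D D'"
    then show ?thesis
      unfolding VRI_def by (rule virtual) (simp_all add: kink_def no_kink_def flagged_def)
  next
    assume "VRII \<psi> D D'"
    then show ?thesis
      unfolding VRII_def by (rule virtual) (simp_all add: bigon_def no_bigon_def flagged_def)
  next
    assume "VRIII \<psi> D D'"
    then show ?thesis
      unfolding VRIII_def
      by (rule virtual) (simp_all add: triangle_def moved_triangle_def flagged_def)
  next
    assume m: "SV \<psi> D D'"
    then obtain p :: "nat \<times> nat" where p: "p \<in> {(1, 2), (2, 1)}"
      and r: "replaces \<psi> (triangle (\<lambda>j k. (j, k) = p)) (moved_triangle (\<lambda>j k. (j, k) = p)) D D'"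
      unfolding SV_def Let_def by blast
    have "flagged (triangle (\<lambda>j k. (j, k) = p)) = {0}"
      "flagged (moved_triangle (\<lambda>j k. (j, k) = p)) = {0}"
      using p unfolding flagged_triangle by (elim insertE emptyE; simp)+
    then show ?thesis
      using triangle_move_crossings[OF r] sv m by (intro reduce) (simp_all add: SV_preserved_def)
  qed
qed

section \<open>Invariance checked on single steps\<close>

lemma link_invariant_iff_step:
  "link_invariant A \<longleftrightarrow> (\<forall>D D'. reidemeister_step D D' \<longrightarrow> A D = A D')"
proof
  assume "link_invariant A"
  then show "\<forall>D D'. reidemeister_step D D' \<longrightarrow> A D = A D'"
    unfolding link_invariant_def virtual_link.abs_eq_iff by blast
next
  assume *: "\<forall>D D'. reidemeister_step D D' \<longrightarrow> A D = A D'"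
  have "A D = A D'" if "equivclp reidemeister_step D D'" for D D'
    using that by (induction rule: equivclp_induct) (use * in auto)
  then show "link_invariant A"
    unfolding link_invariant_def virtual_link.abs_eq_iff by blast
qed

lemma flat_invariant_iff_step:
  "flat_invariant A \<longleftrightarrow>
    link_invariant A \<and> (\<forall>D D'. crossing_change D D' \<longrightarrow> A D = A D')"
proof
  assume "flat_invariant A"
  then show "link_invariant A \<and> (\<forall>D D'. crossing_change D D' \<longrightarrow> A D = A D')"
    unfolding flat_invariant_def link_invariant_iff_step flat_link.abs_eq_iff by blast
next
  assume *: "link_invariant A \<and> (\<forall>D D'. crossing_change D D' \<longrightarrow> A D = A D')"
  have "A D = A D'" if "equivclp (\<lambda>D D'. reidemeister_step D D' \<or> crossing_change D D') D D'" for D D'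
    using that by (induction rule: equivclp_induct) (use *[unfolded link_invariant_iff_step] in auto)
  then show "flat_invariant A"
    unfolding flat_invariant_def flat_link.abs_eq_iff by blast
qed

text \<open>Every clause equates two values of \<open>F\<close>, and equal arguments give equal
  values of \<open>linear_extension A\<close>.\<close>

lemma even_weight_comp:
  assumes "even_weight F"
  shows "even_weight (weight_comp A F)"
  using assms
  unfolding even_weight_def weight_function_def uninvolved_preserved_def RIII_preserved_def
    SV_preserved_def crossing_change_local_def weight_comp_def
  by auto

lemma odd_weight_times:
  assumes "odd_weight u" "even_weight v"
  shows "odd_weight (weight_times u v)"
  using assms
  unfolding even_weight_def odd_weight_def weight_function_def uninvolved_preserved_def
    RIII_preserved_def SV_preserved_def crossing_change_local_def weight_times_def
  by auto

lemma RI_values_zero: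
  assumes "\<And>D. RI_values u D \<subseteq> {0}" "RI \<psi> D D'"
  shows "u D (\<psi> 0) = 0"
  using assms unfolding RI_values_def by blast

text \<open>Indexing the second sum by \<open>crossings (mirror D)\<close> exhibits it as the first
  sum evaluated at \<open>mirror D\<close>.\<close>

lemma flat_I_eq_sum:
  "flat_I D v w g =
    (\<Sum>c\<in>crossings D. if w D c = g then v D c else 0) +
    (\<Sum>c\<in>crossings (mirror D). if w (mirror D) c = g then v (mirror D) c else 0)"
  by (simp add: flat_I_def sum.inter_filter)

theorem flat_I_flat_invariant:
  assumes v: "odd_weight v" and R: "\<And>D. RI_values v D \<subseteq> {0}" and w: "even_weight w"
  shows "flat_invariant (\<lambda>D. flat_I D v w g)"
proof -
  define \<Phi> where "\<Phi> = (\<lambda>D c. if w D c = g then v D c else 0)"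
  have I: "flat_I D v w g = sum (\<Phi> D) (crossings D) + sum (\<Phi> (mirror D)) (crossings (mirror D))" for D
    by (simp add: flat_I_eq_sum \<Phi>_def)
  have unv: "uninvolved_preserved \<Phi>" and R3: "RIII_preserved \<Phi>" and sv: "SV_preserved \<Phi>"
    and loc: "crossing_change_local \<Phi>"
    using v w
    unfolding even_weight_def odd_weight_def weight_function_def uninvolved_preserved_def
      RIII_preserved_def SV_preserved_def crossing_change_local_def \<Phi>_def
    by auto
  have R1: "\<Phi> D (\<psi> 0) = 0" if "RI \<psi> D D'" for \<psi> D D'
    using RI_values_zero[of v, OF R that] by (simp add: \<Phi>_def)
  have R2: "\<Phi> D (\<psi> (Complex 1 0)) = - \<Phi> D (\<psi> (Complex (-1) 0))" if "RII \<psi> D D'" for \<psi> D D'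
  proof -
    \<comment> \<open>Evenness of \<open>w\<close> puts both crossings inside or both outside the
      level \<open>g\<close>; oddness of \<open>v\<close> then cancels them.\<close>
    have "v D (\<psi> (Complex 1 0)) = - v D (\<psi> (Complex (-1) 0))"
      "w D (\<psi> (Complex 1 0)) = w D (\<psi> (Complex (-1) 0))"
      using v w that unfolding odd_weight_def even_weight_def by blast+
    then show ?thesis by (simp add: \<Phi>_def)
  qed
  have step: "sum (\<Phi> D) (crossings D) = sum (\<Phi> D') (crossings D')"
    if "reidemeister_step D D'" for D D'
    using unv R3 sv R1 R2 that by (rule sum_crossings_step)
  show ?thesis
    unfolding flat_invariant_iff_step link_invariant_iff_step
  proof (intro conjI allI impI)
    fix D D' assume "reidemeister_step D D'"
    then show "flat_I D v w g = flat_I D' v w g"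
      unfolding I using step reidemeister_step_mirror by metis
  next
    fix D D' assume "crossing_change D D'"
    then obtain c\<^sub>0 where c0: "c\<^sub>0 \<in> crossings D" and D': "D' = switch {c\<^sub>0} D"
      unfolding crossing_change_def by blast
    have "\<Phi> D' c + \<Phi> (mirror D') c = \<Phi> D c + \<Phi> (mirror D) c" if c: "c \<in> crossings D" for c
    proof (cases "c = c\<^sub>0")
      case True
      then have "\<Phi> (mirror D) c = \<Phi> D' c"
        using crossing_change_local_mirror[OF loc c] D' by simp
      moreover have "\<Phi> (mirror D') c = \<Phi> D c"
        using crossing_change_local_mirror[OF loc, of c D'] c D' True by (simp add: switch_twice)
      ultimately show ?thesis by simp
    next
      case False
      have "\<Phi> D' c = \<Phi> D c"
        using loc c c0 False by (simp add: D' crossing_change_local_def)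
      moreover have "\<Phi> (mirror D') c = \<Phi> (mirror D) c"
        using loc c c0 False
        by (simp add: D' switch_mirror[symmetric] crossing_change_local_def)
      ultimately show ?thesis by simp
    qed
    then show "flat_I D v w g = flat_I D' v w g"
      by (simp add: I D' sum.distrib[symmetric])
  qed
qed

section \<open>Laurent terms and the polynomial\<close>

lemma laurent_term_cong:
  assumes "\<And>i. i \<in> {1..k} \<Longrightarrow> e i = e' i"
  shows "laurent_term k a n e = laurent_term k a n e'"
proof -
  have "(\<Sum>i = 1..k. Poly_Mapping.single i (e i)) = (\<Sum>i = 1..k. Poly_Mapping.single i (e' i))"
    by (intro sum.cong refl) (simp only: assms)
  then show ?thesis by (simp only: laurent_term_def)
qed

lemma laurent_term_uminus: "laurent_term k (- a) n e = - laurent_term k a n e"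
  by (simp add: laurent_term_def single_uminus)

text \<open>The exponent functions are known only on \<open>{1..k}\<close>, so the summand cannot be
  rewritten under the binder. Its shape is that of the unfolded \<open>\<Phi>\<close> in the main
  proof.\<close>

lemma laurent_summand_cong:
  assumes "\<And>i. i \<in> {1..k} \<Longrightarrow> s' i = s i" "\<And>i. i \<in> {1..k} \<Longrightarrow> a' i = a i"
  shows "(if \<forall>i\<in>{1..k}. s' i \<in> R i
      then laurent_term k x n s' - laurent_term k x 0 s'
      else laurent_term k x n s' - laurent_term k x 0 a') =
    (if \<forall>i\<in>{1..k}. s i \<in> R i
      then laurent_term k x n s - laurent_term k x 0 s
      else laurent_term k x n s - laurent_term k x 0 a)"
  using assms laurent_term_cong[of k s' s] laurent_term_cong[of k a' a] by simp

theorem theorem3: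
  fixes A :: "nat \<Rightarrow> vdiagram \<Rightarrow> int"
    and F :: "nat \<Rightarrow> (flat_link \<Rightarrow>\<^sub>0 int) weight"
    and w' u :: "nat \<Rightarrow> int weight"
    and h :: "nat \<Rightarrow> int"
    and k :: nat and m :: "nat \<Rightarrow> nat"
    and s :: "nat \<Rightarrow> int weight"
    and w v :: "int weight"
  assumes "flat_invariant (A 1)"
    and "\<And>i. i \<ge> 1 \<Longrightarrow> even_weight (F i)"
    and "\<And>i. i \<ge> 1 \<Longrightarrow> even_weight (w' i)"
    and "\<And>i. i \<ge> 1 \<Longrightarrow> odd_weight (u i)"
    and "\<And>i D. i \<ge> 1 \<Longrightarrow> RI_values (u i) D \<subseteq> {0}"
    and "\<And>i D. i \<ge> 1 \<Longrightarrow>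
      A (i + 1) D = flat_I D (weight_times (u i) (weight_comp (A i) (F i))) (w' i) (h i)"
    and "\<And>i. i \<in> {1..k} \<Longrightarrow> m i \<ge> 1"
    and "\<And>i. i \<in> {1..k} \<Longrightarrow> s i = weight_comp (A (m i)) (F (m i))"
    and "odd_weight w"
    and "even_weight v"
    and "\<And>D. RI_values v D \<subseteq> {0}"
  shows "link_invariant (\<lambda>D.
      (\<Sum>c\<in>crossings D. laurent_term k (w D c) (v D c) (\<lambda>i. s i D c))
    - (\<Sum>c\<in>special_crossings k s D. laurent_term k (w D c) 0 (\<lambda>i. s i D c))
    - (\<Sum>c\<in>crossings D - special_crossings k s D. laurent_term k (w D c) 0 (\<lambda>i. A (m i) D)))"
proof -
  have flat: "flat_invariant (A i)" if "i \<ge> 1" for i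
    using that
  proof (induction i rule: nat_induct_at_least)
    case (Suc i)
    have "RI_values (weight_times (u i) (weight_comp (A i) (F i))) D \<subseteq> {0}" for D
      using assms(5)[OF Suc.hyps] unfolding RI_values_def weight_times_def by fastforce
    then have "flat_invariant (\<lambda>D. flat_I D (weight_times (u i) (weight_comp (A i) (F i))) (w' i) (h i))"
      using Suc.hyps assms(2-4)
      by (intro flat_I_flat_invariant odd_weight_times even_weight_comp) auto
    moreover have "A (Suc i) = (\<lambda>D. flat_I D (weight_times (u i) (weight_comp (A i) (F i))) (w' i) (h i))"
      using assms(6)[OF Suc.hyps] by (simp add: fun_eq_iff)
    ultimately show ?case by simp
  qed (use assms(1) in simp)
  have A_link: "A (m i) D' = A (m i) D" if "reidemeister_step D D'" "i \<in> {1..k}" for i D D'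
    using flat[OF assms(7)[OF that(2)]] that(1)
    unfolding flat_invariant_iff_step link_invariant_iff_step by metis
  have s_even: "even_weight (s i)" if "i \<in> {1..k}" for i
    using assms(2,7,8) even_weight_comp that by metis
  have link: "link_of D' = link_of D" if "reidemeister_step D D'" for D D'
    using that by (metis virtual_link.abs_eq_iff equivclp_sym r_into_equivclp)

  \<comment> \<open>The three sums regrouped by crossing. The diagram enters the case distinction,
    besides the weights at \<open>c\<close>, only through \<open>link_of D\<close>, and the second
    case through \<open>A (m i) D\<close>; both are constant under a step.\<close>
  define \<Phi> :: "vdiagram \<Rightarrow> complex \<Rightarrow> laurent" where "\<Phi> = (\<lambda>D c.
    if \<forall>i\<in>{1..k}. s i D c \<in> RI_values_link (s i) (link_of D)
    then laurent_term k (w D c) (v D c) (\<lambda>i. s i D c) - laurent_term k (w D c) 0 (\<lambda>i. s i D c)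
    else laurent_term k (w D c) (v D c) (\<lambda>i. s i D c) - laurent_term k (w D c) 0 (\<lambda>i. A (m i) D))"
  have \<Phi>_eq: "\<Phi> D' c' = \<Phi> D c"
    if "reidemeister_step D D'" "w D' c' = w D c" "v D' c' = v D c"
      "\<And>i. i \<in> {1..k} \<Longrightarrow> s i D' c' = s i D c" for D D' c c'
    unfolding \<Phi>_def link[OF that(1)] that(2,3)
    by (rule laurent_summand_cong) (use that(4) A_link[OF that(1)] in simp_all)
  have sum_eq: "(\<Sum>c\<in>crossings D. laurent_term k (w D c) (v D c) (\<lambda>i. s i D c))
    - (\<Sum>c\<in>special_crossings k s D. laurent_term k (w D c) 0 (\<lambda>i. s i D c))
    - (\<Sum>c\<in>crossings D - special_crossings k s D. laurent_term k (w D c) 0 (\<lambda>i. A (m i) D))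
    = sum (\<Phi> D) (crossings D)" for D
  proof -
    let ?T = "special_crossings k s D"
    let ?g = "\<lambda>c. laurent_term k (w D c) (v D c) (\<lambda>i. s i D c)"
    have T: "?T \<subseteq> crossings D" by (auto simp: special_crossings_def)
    have "sum (\<Phi> D) (crossings D) = sum (\<Phi> D) (crossings D - ?T) + sum (\<Phi> D) ?T"
      by (rule sum.subset_diff[OF T]) simp
    also have "sum (\<Phi> D) (crossings D - ?T) = sum ?g (crossings D - ?T) -
        (\<Sum>c\<in>crossings D - ?T. laurent_term k (w D c) 0 (\<lambda>i. A (m i) D))"
      unfolding sum_subtractf[symmetric]
      by (rule sum.cong) (auto simp: \<Phi>_def special_crossings_def)
    also have "sum (\<Phi> D) ?T = sum ?g ?T - (\<Sum>c\<in>?T. laurent_term k (w D c) 0 (\<lambda>i. s i D c))"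
      unfolding sum_subtractf[symmetric]
      by (rule sum.cong) (auto simp: \<Phi>_def special_crossings_def)
    finally show ?thesis
      using sum.subset_diff[OF T finite_crossings, of ?g] by simp
  qed

  have local: "reidemeister_step D D'" if "local_move \<psi> D D'" for \<psi> D D'
    using that unfolding reidemeister_step_def by blast
  have weights: "weight_function w" "weight_function v"
    "\<And>i. i \<in> {1..k} \<Longrightarrow> weight_function (s i)"
    using assms(9,10) s_even by (simp_all add: odd_weight_def even_weight_def)
  have "uninvolved_preserved \<Phi>"
    unfolding uninvolved_preserved_def
  proof (intro conjI allI impI ballI)
    fix h D D' c assume "plane_isotopy h D D'" "c \<in> crossings D"
    then show "\<Phi> D' (h c) = \<Phi> D c"
      using weights by (intro \<Phi>_eq)
        (auto simp: reidemeister_step_def weight_function_def uninvolved_preserved_def)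
  next
    fix \<psi> D D' c assume "local_move \<psi> D D'" "c \<in> crossings D" "c \<notin> \<psi> ` square"
    then show "\<Phi> D' c = \<Phi> D c"
      using weights by (intro \<Phi>_eq local)
        (auto simp: weight_function_def uninvolved_preserved_def)
  qed
  moreover have "RIII_preserved \<Phi>"
    unfolding RIII_preserved_def
  proof (intro allI impI)
    fix \<psi> D D' assume m: "RIII \<psi> D D'"
    then have "reidemeister_step D D'" unfolding reidemeister_step_def local_move_def by blast
    then show "\<Phi> D' (\<psi> (Complex 1 1)) = \<Phi> D (\<psi> (Complex (-1) (-1))) \<and>
        \<Phi> D' (\<psi> (Complex (-1) 1)) = \<Phi> D (\<psi> (Complex 1 (-1))) \<and> \<Phi> D' (\<psi> 0) = \<Phi> D (\<psi> 0)"
      using weights m by (intro conjI \<Phi>_eq) (simp_all add: weight_function_def RIII_preserved_def)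
  qed
  moreover have "SV_preserved \<Phi>"
    unfolding SV_preserved_def
  proof (intro allI impI)
    fix \<psi> D D' assume m: "SV \<psi> D D'"
    then have "reidemeister_step D D'" unfolding reidemeister_step_def local_move_def by blast
    then show "\<Phi> D' (\<psi> 0) = \<Phi> D (\<psi> 0)"
      using weights m by (intro \<Phi>_eq) (simp_all add: weight_function_def SV_preserved_def)
  qed
  moreover have "\<Phi> D (\<psi> 0) = 0" if "RI \<psi> D D'" for \<psi> D D'
  proof -
    \<comment> \<open>The move at hand is itself a witness for membership.\<close>
    have "s i D (\<psi> 0) \<in> RI_values_link (s i) (link_of D)" for i
      using that unfolding RI_values_link_def RI_values_def by blast
    moreover have "v D (\<psi> 0) = 0" using RI_values_zero[OF assms(11) that] .
    ultimately show ?thesis by (simp add: \<Phi>_def)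
  qed
  moreover have "\<Phi> D (\<psi> (Complex 1 0)) = - \<Phi> D (\<psi> (Complex (-1) 0))"
    if m: "RII \<psi> D D'" for \<psi> D D'
  proof -
    let ?c = "\<psi> (Complex 1 0)" and ?c' = "\<psi> (Complex (-1) 0)"
    have wv: "w D ?c = - w D ?c'" "v D ?c = v D ?c'"
      and s: "\<And>i. i \<in> {1..k} \<Longrightarrow> s i D ?c = s i D ?c'"
      using assms(9,10) s_even m unfolding odd_weight_def even_weight_def by blast+
    \<comment> \<open>With the \<open>s i\<close> moved to the other crossing, both crossings fall
      into the same case with equal exponents; only the sign of the coefficient \<open>w\<close>
      differs.\<close>
    have "\<Phi> D ?c = (if \<forall>i\<in>{1..k}. s i D ?c' \<in> RI_values_link (s i) (link_of D)
      then laurent_term k (w D ?c) (v D ?c) (\<lambda>i. s i D ?c') - laurent_term k (w D ?c) 0 (\<lambda>i. s i D ?c')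
      else laurent_term k (w D ?c) (v D ?c) (\<lambda>i. s i D ?c') - laurent_term k (w D ?c) 0 (\<lambda>i. A (m i) D))"
      unfolding \<Phi>_def by (rule laurent_summand_cong) (simp_all add: s)
    then show ?thesis
      unfolding \<Phi>_def wv laurent_term_uminus by simp
  qed
  ultimately show ?thesis
    unfolding link_invariant_iff_step sum_eq using sum_crossings_step[of \<Phi>] by blast
qed

end
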